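(* Let $I_0=[1/10,9/10]$ and $\mathbf c_0(t)=\bigl(\arctan t,\ \tfrac{1}{\sqrt2}\log(1+t^2),\ t-\arctan t\bigr)$, $t\in I_0$ (an arc-length parametrization, with curvature and torsion $\kappa(t)=\tau(t)=\sqrt2/(1+t^2)$), and $C_0=\mathbf c_0(I_0)$. Let $\alpha(t)=\pi(t+10)/24$, let $\mu(t):=\kappa(t)\cos\alpha(t)$, and let $f:=f^{\alpha}$, $\check f:=f^{-\alpha}$ be the developable strips along $\mathbf c_0$; let $\mathbf c_0^\sharp(t)=\mathbf c_0(1-t)$, with curvature $\kappa^\sharp(t)=\kappa(1-t)$, let $\alpha_*:=\arccos(\mu/\kappa^\sharp)\in(0,\pi/2)$, and let $f_*$, $\check f_*$ be the developable strips along $\mathbf c_0^\sharp$ with first angular functions $\alpha_*$, $-\alpha_*$. For $\delta>0$ set $P_1(\delta)=\phi_f(\Omega_\delta)$, $P_2(\delta)=\phi_{\check f}(\Omega_\delta)$, $P_3(\delta)=\phi_{f_*}(\Omega_\delta)$, $P_4(\delta)=\phi_{\check f_*}(\Omega_\delta)$, where $\Omega_\delta=I_0\times(-\delta,\delta)$. Then for every sufficiently small $\epsilon>0$, every $\delta\in(0,\epsilon]$ and all $i,j\in\{1,2,3,4\}$: if an isometry $T$ of $\mathbb R^3$ satisfies $T(P_i(\delta))\subset P_j(\epsilon)$, then $i=j$. In particular the four curved foldings $P_1(\epsilon),\dots,P_4(\epsilon)$, which all have crease $C_0$ and the same crease pattern (the plane curve with curvature $\mu$), are mutually non-congruent.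
   Context: Space curves. For a $C^\infty$ curve $\sigma:I\to\mathbb R^3$ parametrized by arc length with curvature $\kappa_\sigma=|\sigma''|>0$, set $\mathbf e=\sigma'$, $\mathbf n=\sigma''/\kappa_\sigma$, $\mathbf b=\mathbf e\times\mathbf n$, and define the torsion by $\tau_\sigma:=\mathbf n'\cdot\mathbf b$. Developable strips. Given $C^\infty$ functions $\alpha,\beta$ on $I$ with $0<|\alpha(t)|<\pi/2$ and $0<\beta(t)<\pi$, the ruled surface along $\sigma$ is $f(t,v)=\sigma(t)+v\,\xi(t)$ for $(t,v)\in I\times(-\epsilon,\epsilon)$, where $\xi=\cos\beta\,\mathbf e+\sin\beta(\cos\alpha\,\mathbf n+\sin\alpha\,\mathbf b)$; $\alpha$ is the first angular function. $f$ is a developable strip iff $\cot\beta=(\alpha'+\tau_\sigma)/(\kappa_\sigma\sin\alpha)$; the developable strip along $\sigma$ with first angular function $\alpha$ is denoted $f^\alpha$, and the geodesic curvature of $\sigma$ on $f^\alpha$ is $\kappa_\sigma\cos\alpha$. The dual of $f=f^\alpha$ is $\check f:=f^{-\alpha}$. Origami maps. $\phi_f(t,v)=f(t,v)$ for $v\ge0$ and $\phi_f(t,v)=\check f(t,v)$ for $v<0$; $\psi_f(t,v)=\check f(t,v)$ for $v\ge0$ and $\psi_f(t,v)=f(t,v)$ for $v<0$. The image of $\phi_f$ is a curved folding with crease $\sigma(I)$. *)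

theory Defs
  imports "HOL-Analysis.Analysis"
begin

text \<open>Frenet apparatus of a curve sigma : real -> R^3 (assumed parametrized by arc length).\<close>

definition tangent :: "(real \<Rightarrow> real^3) \<Rightarrow> real \<Rightarrow> real^3" where
  "tangent \<sigma> t = vector_derivative \<sigma> (at t)"

definition accel :: "(real \<Rightarrow> real^3) \<Rightarrow> real \<Rightarrow> real^3" where
  "accel \<sigma> t = vector_derivative (tangent \<sigma>) (at t)"

definition curvature :: "(real \<Rightarrow> real^3) \<Rightarrow> real \<Rightarrow> real" where
  "curvature \<sigma> t = norm (accel \<sigma> t)"

definition normal :: "(real \<Rightarrow> real^3) \<Rightarrow> real \<Rightarrow> real^3" where
  "normal \<sigma> t = (1 / curvature \<sigma> t) *\<^sub>R accel \<sigma> t"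

definition binormal :: "(real \<Rightarrow> real^3) \<Rightarrow> real \<Rightarrow> real^3" where
  "binormal \<sigma> t = cross3 (tangent \<sigma> t) (normal \<sigma> t)"

definition torsion :: "(real \<Rightarrow> real^3) \<Rightarrow> real \<Rightarrow> real" where
  "torsion \<sigma> t = inner (vector_derivative (normal \<sigma>) (at t)) (binormal \<sigma> t)"

text \<open>Second angular function beta of the developable strip with first angular function alpha:
  the unique beta in (0,pi) with cot beta = (alpha' + tau)/(kappa sin alpha).\<close>

definition strip_beta :: "(real \<Rightarrow> real^3) \<Rightarrow> (real \<Rightarrow> real) \<Rightarrow> real \<Rightarrow> real" where
  "strip_beta \<sigma> \<alpha> t =
     pi / 2 - arctan ((deriv \<alpha> t + torsion \<sigma> t) / (curvature \<sigma> t * sin (\<alpha> t)))"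

definition ruling :: "(real \<Rightarrow> real^3) \<Rightarrow> (real \<Rightarrow> real) \<Rightarrow> real \<Rightarrow> real^3" where
  "ruling \<sigma> \<alpha> t =
     cos (strip_beta \<sigma> \<alpha> t) *\<^sub>R tangent \<sigma> t
     + sin (strip_beta \<sigma> \<alpha> t) *\<^sub>R
         (cos (\<alpha> t) *\<^sub>R normal \<sigma> t + sin (\<alpha> t) *\<^sub>R binormal \<sigma> t)"

definition dev_strip :: "(real \<Rightarrow> real^3) \<Rightarrow> (real \<Rightarrow> real) \<Rightarrow> real \<Rightarrow> real \<Rightarrow> real^3" where
  "dev_strip \<sigma> \<alpha> t v = \<sigma> t + v *\<^sub>R ruling \<sigma> \<alpha> t"

text \<open>Origami map phi_f for f = f^alpha (its dual is f^(-alpha)).\<close>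
definition origami_phi :: "(real \<Rightarrow> real^3) \<Rightarrow> (real \<Rightarrow> real) \<Rightarrow> real \<times> real \<Rightarrow> real^3" where
  "origami_phi \<sigma> \<alpha> p =
     (if snd p \<ge> 0 then dev_strip \<sigma> \<alpha> (fst p) (snd p)
      else dev_strip \<sigma> (\<lambda>s. - \<alpha> s) (fst p) (snd p))"

definition isometry3 :: "(real^3 \<Rightarrow> real^3) \<Rightarrow> bool" where
  "isometry3 T \<longleftrightarrow> (\<forall>x y. dist (T x) (T y) = dist x y)"

definition I0 :: "real set" where "I0 = {1/10 .. 9/10}"

definition c0 :: "real \<Rightarrow> real^3" where
  "c0 t = vector [arctan t, (1 / sqrt 2) * ln (1 + t\<^sup>2), t - arctan t]"

definition c0s :: "real \<Rightarrow> real^3" where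
  "c0s t = c0 (1 - t)"

definition alpha0 :: "real \<Rightarrow> real" where
  "alpha0 t = pi * (t + 10) / 24"

definition mu0 :: "real \<Rightarrow> real" where
  "mu0 t = curvature c0 t * cos (alpha0 t)"

definition alphas :: "real \<Rightarrow> real" where
  "alphas t = arccos (mu0 t / curvature c0s t)"

definition Omega :: "real \<Rightarrow> (real \<times> real) set" where
  "Omega \<delta> = I0 \<times> {-\<delta> <..< \<delta>}"

definition Pfold :: "nat \<Rightarrow> real \<Rightarrow> (real^3) set" where
  "Pfold i \<delta> =
     (if i = 1 then origami_phi c0 alpha0 ` Omega \<delta>
      else if i = 2 then origami_phi c0 (\<lambda>s. - alpha0 s) ` Omega \<delta>
      else if i = 3 then origami_phi c0s alphas ` Omega \<delta>
      else origami_phi c0s (\<lambda>s. - alphas s) ` Omega \<delta>)"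

end

theory Submission
  imports Defs
begin

text \<open>Let \<open>u\<close>, \<open>v\<close> be the directions in which the two halves of a folding leave the crease. Since the tangent,
  \<open>u\<close> and \<open>v\<close> are linearly independent, \<open>(t, a, b) \<mapsto> c0 t + a u t + b v t\<close> is a diffeomorphism near
  the crease, and it carries \<open>{a, b \<ge> 0, a b = 0}\<close> onto the folding. Hence the one-sided tangent vectors
  of the folding lie in a plane off the crease, and form two half planes on it. An isometry \<open>T\<close>
  taking one folding into another must therefore map crease to crease and \<open>c0'\<close> to \<open>\<plusminus> c0'\<close>.
  As \<open>c0\<close> makes a constant angle with the axis \<open>(1, 0, 1)\<close> and its parameter is the coordinate along that axis,
  \<open>T\<close> either fixes the crease pointwise or reverses it by \<open>t \<mapsto> 1 - t\<close>; the latter does not preserve the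
  angles between tangents. So \<open>T\<close> is the identity, and the foldings are distinguished by their half planes
  at \<open>c0 (1/5)\<close>.\<close>

section \<open>Tubular coordinates along a framed curve\<close>

text \<open>The hypothesis compares subsets of space, so an isometry need not a priori respect
  strips, rulings or parameters; what it does transport is one-sided tangent vectors, one-sided
  because a folding has a corner along its crease. All four foldings are brought to one form over
  \<open>c0\<close>: reversing the crease keeps the normal and flips tangent and binormal. The dual
  strip is used on the side v < 0, so its ruling enters with a minus sign, and the two halves leave
  the crease with normal-plane components proportional to (A, B) and (-A, B), where A is the cosine
  and B up to sign the sine of the angle. Their determinant 2AB is nonzero, which yields the tubular
  coordinates. The condition A > 0 tells the two half planes apart, so once the isometry is the
  identity the pairs (A, B) must agree. They are compared at 1/5, which is 4/5 on the reversed
  crease. The midpoint 1/2 could not separate the first folding from the fourth: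
  \<open>alpha0\<close> and \<open>alphas\<close> coincide there.\<close>

lemma inj_on_near_compact:
  fixes f :: "'a::heine_borel \<Rightarrow> 'b::t2_space"
  assumes K: "compact K" "K \<subseteq> V" and V: "open V" "continuous_on V f"
    and inj: "inj_on f K"
    and loc: "\<And>x. x \<in> K \<Longrightarrow> \<exists>r>0. inj_on f (ball x r)"
  shows "\<exists>e>0. inj_on f (\<Union>x\<in>K. ball x e)"
proof (rule ccontr)
  assume neg: "\<not> ?thesis"
  \<comment> \<open>Take colliding pairs ever closer to \<open>K\<close>. Subsequential limits l, m
    lie in \<open>K\<close> and have equal images, so l = m by injectivity on \<open>K\<close>;
    local injectivity at this common limit then excludes the pairs.\<close>
  have "\<forall>n. \<exists>x y a b. x \<noteq> y \<and> f x = f y \<and> a \<in> K \<and> b \<in> K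
          \<and> dist a x < inverse (real (Suc n)) \<and> dist b y < inverse (real (Suc n))"
  proof
    fix n
    have "\<not> inj_on f (\<Union>x\<in>K. ball x (inverse (real (Suc n))))"
      using neg by (metis inverse_positive_iff_positive of_nat_0_less_iff zero_less_Suc)
    then show "\<exists>x y a b. x \<noteq> y \<and> f x = f y \<and> a \<in> K \<and> b \<in> K
          \<and> dist a x < inverse (real (Suc n)) \<and> dist b y < inverse (real (Suc n))"
      unfolding inj_on_def by (auto simp: mem_ball) blast
  qed
  then obtain x y a b where *: "\<And>n. x n \<noteq> y n" "\<And>n. f (x n) = f (y n)" "\<And>n. a n \<in> K" "\<And>n. b n \<in> K"
     "\<And>n. dist (a n) (x n) < inverse (real (Suc n))" "\<And>n. dist (b n) (y n) < inverse (real (Suc n))"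
    by metis
  obtain l r where l: "l \<in> K" "strict_mono r" "(a \<circ> r) \<longlonglongrightarrow> l"
    using K(1) *(3) unfolding compact_def by metis
  obtain m q where m: "m \<in> K" "strict_mono q" "((b \<circ> r) \<circ> q) \<longlonglongrightarrow> m"
    using K(1) *(4) unfolding compact_def by (metis comp_apply)
  define s where "s = r \<circ> q"
  have s: "strict_mono s" using l(2) m(2) by (simp add: s_def strict_mono_o)
  have al: "(a \<circ> s) \<longlonglongrightarrow> l" using LIMSEQ_subseq_LIMSEQ[OF l(3) m(2)] by (simp add: s_def o_assoc)
  have bm: "(b \<circ> s) \<longlonglongrightarrow> m" using m(3) by (simp add: s_def o_assoc)
  have inv0: "(\<lambda>n. inverse (real (Suc (s n)))) \<longlonglongrightarrow> 0"
    using LIMSEQ_subseq_LIMSEQ[OF LIMSEQ_inverse_real_of_nat s] by (simp add: o_def)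
  have d0: "(\<lambda>n. dist ((a \<circ> s) n) (x (s n))) \<longlonglongrightarrow> 0" "(\<lambda>n. dist ((b \<circ> s) n) (y (s n))) \<longlonglongrightarrow> 0"
    by (rule tendsto_sandwich[OF _ _ tendsto_const inv0];
        use *(5,6) in \<open>auto intro!: always_eventually less_imp_le simp del: of_nat_Suc\<close>)+
  have close: "g \<longlonglongrightarrow> z" if "f \<longlonglongrightarrow> z" "(\<lambda>n. dist (f n) (g n)) \<longlonglongrightarrow> 0"
    for f g :: "nat \<Rightarrow> 'a" and z
  proof -
    have lim: "(\<lambda>n. dist (f n) (g n) + dist (f n) z) \<longlonglongrightarrow> 0"
      using tendsto_add[OF that(2) tendsto_dist_iff[THEN iffD1, OF that(1)]] by simp
    show ?thesis
      by (rule tendsto_dist_iff[THEN iffD2], rule tendsto_sandwich[OF _ _ tendsto_const lim]) (simp_all add: dist_triangle3)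
  qed
  have xl: "(\<lambda>n. x (s n)) \<longlonglongrightarrow> l"
    by (rule close[OF al d0(1)])
  have yl: "(\<lambda>n. y (s n)) \<longlonglongrightarrow> m"
    by (rule close[OF bm d0(2)])
  have cl: "isCont f l" "isCont f m"
    using K(2) l(1) m(1) V by (auto simp: continuous_on_eq_continuous_at)
  have "(\<lambda>n. f (x (s n))) \<longlonglongrightarrow> f l" using isCont_tendsto_compose[OF cl(1) xl] .
  moreover have "(\<lambda>n. f (x (s n))) \<longlonglongrightarrow> f m" using isCont_tendsto_compose[OF cl(2) yl] *(2) by simp
  ultimately have "f l = f m" by (rule LIMSEQ_unique)
  then have lm: "l = m" using inj l(1) m(1) by (auto dest: inj_onD)
  obtain e where e: "e > 0" "inj_on f (ball l e)" using loc l(1) by blast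
  have "\<forall>\<^sub>F n in sequentially. dist (x (s n)) l < e" using xl e(1) by (rule tendstoD)
  moreover have "\<forall>\<^sub>F n in sequentially. dist (y (s n)) l < e" using yl e(1) unfolding lm by (rule tendstoD)
  ultimately have "\<forall>\<^sub>F n in sequentially. False"
  proof eventually_elim
    case (elim n)
    then show ?case using inj_onD[OF e(2) *(2)[of "s n"]] *(1)[of "s n"] by (auto simp: mem_ball dist_commute)
  qed
  then show False by simp
qed

definition frame_map :: "(real \<Rightarrow> real^3) \<Rightarrow> (real \<Rightarrow> real^3) \<Rightarrow> (real \<Rightarrow> real^3) \<Rightarrow> real^3 \<Rightarrow> real^3" where
  "frame_map p u v X = p (X$1) + X$2 *\<^sub>R u (X$1) + X$3 *\<^sub>R v (X$1)"

lemma frame_map_has_derivative: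
  assumes "(p has_vector_derivative p') (at (X$1))" "(u has_vector_derivative u') (at (X$1))"
    "(v has_vector_derivative v') (at (X$1))"
  shows "(frame_map p u v has_derivative
     (\<lambda>Y. Y$1 *\<^sub>R (p' + X$2 *\<^sub>R u' + X$3 *\<^sub>R v') + Y$2 *\<^sub>R u (X$1) + Y$3 *\<^sub>R v (X$1))) (at X)"
proof -
  have c: "((\<lambda>X::real^3. X$i) has_derivative (\<lambda>Y. Y$i)) (at X)" for i
    by (rule bounded_linear_imp_has_derivative[OF bounded_linear_vec_nth])
  have d: "((\<lambda>X. f (X$1)) has_derivative (\<lambda>Y. Y$1 *\<^sub>R f')) (at X)"
    if "(f has_vector_derivative f') (at (X$1))" for f :: "real \<Rightarrow> real^3" and f'
    using has_derivative_compose[OF c[of 1]] that unfolding has_vector_derivative_def by fastforce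
  show ?thesis
    unfolding frame_map_def
    by (rule derivative_eq_intros c d assms | rule refl ext)+ (simp add: algebra_simps scaleR_add_right)
qed

text \<open>Cramer's rule: the inner product with the cross product of two of the vectors isolates
  the coefficient of the third.\<close>

lemma triple_nonzero_imp_injective:
  fixes m u v :: "real^3"
  assumes "m \<bullet> cross3 u v \<noteq> 0" "a *\<^sub>R m + b *\<^sub>R u + c *\<^sub>R v = 0"
  shows "a = 0 \<and> b = 0 \<and> c = 0"
proof -
  have "cross3 u v \<bullet> (a *\<^sub>R m + b *\<^sub>R u + c *\<^sub>R v) = a * (m \<bullet> cross3 u v)"
       "cross3 v m \<bullet> (a *\<^sub>R m + b *\<^sub>R u + c *\<^sub>R v) = b * (m \<bullet> cross3 u v)"
       "cross3 m u \<bullet> (a *\<^sub>R m + b *\<^sub>R u + c *\<^sub>R v) = c * (m \<bullet> cross3 u v)"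
    by (simp_all add: cross3_simps)
  with assms show ?thesis by auto
qed

lemma triple_map_linear_inj:
  fixes m u v :: "real^3"
  assumes "m \<bullet> cross3 u v \<noteq> 0"
  shows "linear (\<lambda>Z::real^3. Z$1 *\<^sub>R m + Z$2 *\<^sub>R u + Z$3 *\<^sub>R v)"
    and "inj (\<lambda>Z::real^3. Z$1 *\<^sub>R m + Z$2 *\<^sub>R u + Z$3 *\<^sub>R v)" (is "inj ?f")
proof -
  show lin: "linear ?f" by (rule linearI) (simp_all add: algebra_simps)
  show "inj ?f"
    unfolding linear_injective_0[OF lin]
  proof (intro allI impI)
    fix Z assume "?f Z = 0"
    from triple_nonzero_imp_injective[OF assms this] show "Z = 0" by (simp add: vec_eq_iff forall_3)
  qed
qed

text \<open>The derivative has columns m, u, v with m = p' + X$2 u' + X$3 v', so the triple product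
  in the last hypothesis is the Jacobian. These columns depend continuously on the point, hence so
  does the derivative in operator norm.\<close>

lemma frame_map_locally_injective:
  assumes J: "open J" "X$1 \<in> J"
    and p: "\<And>t. t \<in> J \<Longrightarrow> (p has_vector_derivative p' t) (at t)" "continuous_on J p'"
    and u: "\<And>t. t \<in> J \<Longrightarrow> (u has_vector_derivative u' t) (at t)" "continuous_on J u'"
    and v: "\<And>t. t \<in> J \<Longrightarrow> (v has_vector_derivative v' t) (at t)" "continuous_on J v'"
    and nz: "(p' (X$1) + X$2 *\<^sub>R u' (X$1) + X$3 *\<^sub>R v' (X$1)) \<bullet> cross3 (u (X$1)) (v (X$1)) \<noteq> 0"
  shows "\<exists>r>0. inj_on (frame_map p u v) (ball X r)"
proof -
  define S where "S = {Y::real^3. Y$1 \<in> J}"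
  have S: "open S" "X \<in> S"
    using J open_vimage[OF J(1), of "\<lambda>Y::real^3. Y$1"] by (auto simp: S_def vimage_def continuous_intros)
  define m where "m Y = p' (Y$1) + Y$2 *\<^sub>R u' (Y$1) + Y$3 *\<^sub>R v' (Y$1)" for Y :: "real^3"
  define D where "D Y Z = Z$1 *\<^sub>R m Y + Z$2 *\<^sub>R u (Y$1) + Z$3 *\<^sub>R v (Y$1)" for Y Z :: "real^3"
  have der: "(frame_map p u v has_derivative D Y) (at Y)" if "Y \<in> S" for Y
    using frame_map_has_derivative[of p "p' (Y$1)" Y u "u' (Y$1)" v "v' (Y$1)"] that p u v
    unfolding S_def D_def m_def by auto
  have lin: "linear (D X)" and inj: "inj (D X)"
    using triple_map_linear_inj[OF nz] unfolding D_def[abs_def] m_def .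
  obtain g where g: "linear g" "g \<circ> D X = id"
    using linear_injective_left_inverse[OF lin inj] by blast
  have cu: "continuous_on J u" "continuous_on J v"
    using u v by (auto intro!: continuous_at_imp_continuous_on has_vector_derivative_continuous)
  have cc: "continuous_on S (\<lambda>Y. f (Y$1))" if "continuous_on J f" for f :: "real \<Rightarrow> real^3"
    by (rule continuous_on_compose2[OF that]) (auto simp: S_def intro!: continuous_intros)
  have cm: "continuous_on S m"
    unfolding m_def by (intro continuous_intros cc p u v)
  let ?N = "\<lambda>Y. norm (m Y - m X) + norm (u (Y$1) - u (X$1)) + norm (v (Y$1) - v (X$1))"
  have cN: "continuous_on S ?N"
    by (intro continuous_intros cm cc cu)
  have "isCont ?N X" using cN S by (simp add: continuous_on_eq_continuous_at)
  then have Nlim: "(?N \<longlongrightarrow> 0) (at X)" by (auto simp: isCont_def)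
  have small: "\<exists>d>0. \<forall>Y. dist X Y < d \<longrightarrow> onorm (\<lambda>Z. D Y Z - D X Z) < e" if e0: "e > 0" for e
  proof -
    obtain d where d: "d > 0" "\<And>Y. dist X Y < d \<Longrightarrow> ?N Y < e"
    proof -
      obtain d where d: "d > 0" "\<And>Y. Y \<noteq> X \<Longrightarrow> dist Y X < d \<Longrightarrow> dist (?N Y) 0 < e"
        using tendstoD[OF Nlim e0] unfolding eventually_at by blast
      have "?N Y < e" if "dist X Y < d" for Y
        using d(2)[of Y] that e0 by (cases "Y = X") (auto simp: dist_commute)
      with d(1) show ?thesis using that by blast
    qed
    have "onorm (\<lambda>Z. D Y Z - D X Z) < e" if "dist X Y < d" for Y
    proof -
      \<comment> \<open>The operator norm is at most the sum of the norms of the columns, since each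
        coordinate of \<open>Z\<close> is bounded by its norm.\<close>
      have "onorm (\<lambda>Z. D Y Z - D X Z) \<le> ?N Y"
      proof (rule onorm_le)
        fix Z :: "real^3"
        have eq: "D Y Z - D X Z = Z$1 *\<^sub>R (m Y - m X) + Z$2 *\<^sub>R (u (Y$1) - u (X$1)) + Z$3 *\<^sub>R (v (Y$1) - v (X$1))"
          by (simp add: D_def algebra_simps)
        have "norm (D Y Z - D X Z) \<le> \<bar>Z$1\<bar> * norm (m Y - m X) + \<bar>Z$2\<bar> * norm (u (Y$1) - u (X$1))
            + \<bar>Z$3\<bar> * norm (v (Y$1) - v (X$1))"
          unfolding eq by (metis (no_types, lifting) norm_add_rule_thm norm_scaleR order_refl)
        also have "\<dots> \<le> norm Z * norm (m Y - m X) + norm Z * norm (u (Y$1) - u (X$1))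
            + norm Z * norm (v (Y$1) - v (X$1))"
          by (intro add_mono mult_right_mono component_le_norm_cart) auto
        finally show "norm (D Y Z - D X Z) \<le> ?N Y * norm Z" by (simp add: algebra_simps)
      qed
      with d(2)[OF that] show ?thesis by linarith
    qed
    with d(1) show ?thesis by blast
  qed
  obtain r where "r > 0" "inj_on (frame_map p u v) (ball X r)"
    using has_derivative_locally_injective[OF S(2) S(1) _ g(2) der small] g(1) linear_conv_bounded_linear
    by metis
  then show ?thesis by blast
qed

text \<open>On the axis X$2 = X$3 = 0 the map is \<open>p\<close>, injective on \<open>K\<close>,
  and the Jacobian there is \<open>p' t \<bullet> cross3 (u t) (v t)\<close>. Local injectivity
  therefore spreads to a uniform neighbourhood of the compact axis, which is shrunk to keep the
  Jacobian nonzero.\<close>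

lemma frame_map_tube:
  assumes J: "open J" "K \<subseteq> J" "compact K"
    and p: "\<And>t. t \<in> J \<Longrightarrow> (p has_vector_derivative p' t) (at t)" "continuous_on J p'"
    and u: "\<And>t. t \<in> J \<Longrightarrow> (u has_vector_derivative u' t) (at t)" "continuous_on J u'"
    and v: "\<And>t. t \<in> J \<Longrightarrow> (v has_vector_derivative v' t) (at t)" "continuous_on J v'"
    and inj: "inj_on p K"
    and nz: "\<And>t. t \<in> K \<Longrightarrow> p' t \<bullet> cross3 (u t) (v t) \<noteq> 0"
  shows "\<exists>U e. open U \<and> e > 0 \<and> inj_on (frame_map p u v) U
    \<and> (\<forall>X\<in>U. X$1 \<in> J \<and>
          (p' (X$1) + X$2 *\<^sub>R u' (X$1) + X$3 *\<^sub>R v' (X$1)) \<bullet> cross3 (u (X$1)) (v (X$1)) \<noteq> 0)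
    \<and> (\<forall>X. X$1 \<in> K \<and> \<bar>X$2\<bar> < e \<and> \<bar>X$3\<bar> < e \<longrightarrow> X \<in> U)"
proof -
  define S where "S = {Y::real^3. Y$1 \<in> J}"
  define \<Delta> where "\<Delta> X = (p' (X$1) + X$2 *\<^sub>R u' (X$1) + X$3 *\<^sub>R v' (X$1)) \<bullet> cross3 (u (X$1)) (v (X$1))"
    for X :: "real^3"
  have S: "open S"
    using open_vimage[OF J(1), of "\<lambda>Y::real^3. Y$1"] by (auto simp: S_def vimage_def continuous_intros)
  have cu: "continuous_on J p" "continuous_on J u" "continuous_on J v"
    using p u v by (auto intro!: continuous_at_imp_continuous_on has_vector_derivative_continuous)
  have cc: "continuous_on S (\<lambda>Y. f (Y$1))" if "continuous_on J f" for f :: "real \<Rightarrow> real^3"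
    by (rule continuous_on_compose2[OF that]) (auto simp: S_def intro!: continuous_intros)
  have c\<Delta>: "continuous_on S \<Delta>"
    unfolding \<Delta>_def by (intro continuous_intros continuous_on_cross cc p u v cu)
  have cf: "continuous_on S (frame_map p u v)"
    unfolding frame_map_def by (intro continuous_intros cc cu)
  define V where "V = S \<inter> \<Delta> -` (- {0})"
  have V: "open V" unfolding V_def by (rule continuous_open_preimage[OF c\<Delta> S]) auto
  define h where "h t = (vector [t,0,0] :: real^3)" for t :: real
  have h: "h t $ 1 = t" "h t $ 2 = 0" "h t $ 3 = 0" for t
    by (simp_all add: h_def)
  have "h = (\<lambda>t. t *\<^sub>R axis 1 1)" by (simp add: fun_eq_iff vec_eq_iff forall_3 h axis_def)
  then have K': "compact (h ` K)"
    by (intro compact_continuous_image J) (simp add: continuous_intros)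
  have KV: "h ` K \<subseteq> V" using J(2) nz by (auto simp: V_def S_def \<Delta>_def h)
  have "\<exists>e>0. inj_on (frame_map p u v) (\<Union>x\<in>h ` K. ball x e)"
  proof (rule inj_on_near_compact[OF K' KV V])
    show "continuous_on V (frame_map p u v)" using cf continuous_on_subset by (fastforce simp: V_def)
    show "inj_on (frame_map p u v) (h ` K)"
      using inj by (auto simp: inj_on_def frame_map_def h)
    show "\<exists>r>0. inj_on (frame_map p u v) (ball x r)" if "x \<in> h ` K" for x
      using that KV by (intro frame_map_locally_injective[OF J(1) _ p u v]) (auto simp: V_def S_def \<Delta>_def h)
  qed
  then obtain e1 where e1: "e1 > 0" "inj_on (frame_map p u v) (\<Union>x\<in>h ` K. ball x e1)" by blast
  obtain e2 where e2: "e2 > 0" "(\<Union>x\<in>h ` K. ball x e2) \<subseteq> V"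
    using compact_subset_open_imp_ball_epsilon_subset[OF K' V KV] by blast
  define e where "e = min e1 e2"
  define U where "U = (\<Union>x\<in>h ` K. ball x e)"
  have "open U" unfolding U_def by blast
  moreover have "inj_on (frame_map p u v) U"
    by (rule inj_on_subset[OF e1(2)]) (auto simp: U_def e_def)
  moreover have "U \<subseteq> V" using e2(2) by (fastforce simp: U_def e_def subset_iff)
  \<comment> \<open>Half the radius suffices: the distance to the axis point is at most the sum of
    the two transverse coordinates.\<close>
  moreover have "X \<in> U" if "X$1 \<in> K" "\<bar>X$2\<bar> < e/2" "\<bar>X$3\<bar> < e/2" for X
  proof -
    have "norm (h (X$1) - X) \<le> (\<Sum>i\<in>UNIV. \<bar>(h (X$1) - X)$i\<bar>)" by (rule norm_le_l1_cart)
    also have "\<dots> < e" using that by (simp add: sum_3 h)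
    finally have "X \<in> ball (h (X$1)) e" by (simp add: mem_ball dist_norm)
    then show ?thesis using that(1) by (auto simp: U_def)
  qed
  moreover have "e/2 > 0" using e1 e2 by (simp add: e_def)
  ultimately show ?thesis
    by (intro exI[of _ U] exI[of _ "e/2"]) (auto simp: V_def S_def \<Delta>_def)
qed

section \<open>One-sided tangent vectors\<close>

text \<open>Only the derivative at the starting point is required; the curve may be arbitrary inside
  \<open>P\<close> otherwise. This makes the notion monotone in \<open>P\<close> and stable under
  affine maps.\<close>

definition right_tangent :: "(real^3) set \<Rightarrow> real^3 \<Rightarrow> real^3 \<Rightarrow> bool" where
  "right_tangent P q w \<longleftrightarrow> (\<exists>\<gamma>. \<gamma> 0 = q \<and> (\<gamma> has_vector_derivative w) (at 0 within {0..})
     \<and> (\<exists>d>0. \<forall>s\<in>{0..<d}. \<gamma> s \<in> P))"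

lemma right_tangent_mono: "right_tangent P q w \<Longrightarrow> P \<subseteq> Q \<Longrightarrow> right_tangent Q q w"
  unfolding right_tangent_def by blast

lemma right_tangent_segment:
  assumes "d > 0" "\<And>s. 0 \<le> s \<Longrightarrow> s < d \<Longrightarrow> q + s *\<^sub>R w \<in> P"
  shows "right_tangent P q w"
  unfolding right_tangent_def
proof (intro exI conjI)
  show "((\<lambda>s. q + s *\<^sub>R w) has_vector_derivative w) (at 0 within {0..})"
    unfolding has_vector_derivative_def
    by (rule derivative_eq_intros | rule refl)+ simp
qed (use assms in auto)

lemma right_tangent_isometry:
  assumes "right_tangent P q w" "linear L" "\<And>x. T x = c + L x"
  shows "right_tangent (T ` P) (T q) (L w)"
proof -
  obtain \<gamma> d where g: "\<gamma> 0 = q" "(\<gamma> has_vector_derivative w) (at 0 within {0..})" "d > 0" "\<forall>s\<in>{0..<d}. \<gamma> s \<in> P"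
    using assms(1) unfolding right_tangent_def by blast
  have "bounded_linear L" using assms(2) linear_conv_bounded_linear by blast
  from bounded_linear.has_vector_derivative[OF this g(2)]
  have "((\<lambda>s. T (\<gamma> s)) has_vector_derivative L w) (at 0 within {0..})"
    unfolding assms(3) by (auto intro!: derivative_eq_intros)
  then show ?thesis unfolding right_tangent_def
    using g by (intro exI[of _ "\<lambda>s. T (\<gamma> s)"]) auto
qed

text \<open>Off the origin the active coordinate stays positive for a while, which forces the other
  one to vanish. At the origin the curve may switch branches infinitely often, so no branch is
  chosen: the difference quotients are nonnegative with product 0, and both facts pass to the
  limit.\<close>

lemma derivative_of_quadrant_cross:
  fixes a b :: "real \<Rightarrow> real"
  assumes a: "(a has_vector_derivative a') (at 0 within {0..})"
    and b: "(b has_vector_derivative b') (at 0 within {0..})"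
    and d: "d > 0" "\<And>s. 0 \<le> s \<Longrightarrow> s < d \<Longrightarrow> a s \<ge> 0 \<and> b s \<ge> 0 \<and> a s * b s = 0"
  shows "a 0 > 0 \<Longrightarrow> b' = 0"
    and "a 0 = 0 \<Longrightarrow> b 0 = 0 \<Longrightarrow> a' \<ge> 0 \<and> b' \<ge> 0 \<and> a' * b' = 0"
proof -
  have qa: "((\<lambda>s. (a s - a 0) / s) \<longlongrightarrow> a') (at_right 0)"
   and qb: "((\<lambda>s. (b s - b 0) / s) \<longlongrightarrow> b') (at_right 0)"
    using a b unfolding has_real_derivative_iff_has_vector_derivative[symmetric] has_field_derivative_iff
    by (auto elim!: tendsto_mono[OF at_le, rotated])
  have near: "\<forall>\<^sub>F s in at_right 0. 0 < s \<and> s < d"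
    using d(1) by (auto simp: eventually_at_right)
  {
    assume a0: "a 0 > 0"
    have b0: "b 0 = 0" using d(2)[of 0] d(1) a0 by auto
    have "continuous (at 0 within {0..}) a" using a has_vector_derivative_continuous by blast
    then have "(a \<longlongrightarrow> a 0) (at_right 0)"
      unfolding continuous_within by (rule tendsto_mono[OF at_le, rotated]) auto
    then have "\<forall>\<^sub>F s in at_right 0. a s > 0" using a0 by (rule order_tendstoD)
    then have "\<forall>\<^sub>F s in at_right 0. (b s - b 0) / s = 0"
      using near
    proof eventually_elim
      case (elim s)
      then show ?case using d(2)[of s] b0 by auto
    qed
    then have "((\<lambda>s. (b s - b 0) / s) \<longlongrightarrow> 0) (at_right 0)" by (rule tendsto_eventually)
    then show "b' = 0" using qb by (meson tendsto_unique trivial_limit_at_right_real)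
  }
  {
    assume z: "a 0 = 0" "b 0 = 0"
    have "\<forall>\<^sub>F s in at_right 0. 0 \<le> (a s - a 0) / s"
      using near by eventually_elim (use d(2) z in auto)
    then have 1: "a' \<ge> 0" using qa by (intro tendsto_lowerbound[of _ a' "at_right 0" 0]) auto
    have "\<forall>\<^sub>F s in at_right 0. 0 \<le> (b s - b 0) / s"
      using near by eventually_elim (use d(2) z in auto)
    then have 2: "b' \<ge> 0" using qb by (intro tendsto_lowerbound[of _ b' "at_right 0" 0]) auto
    have "\<forall>\<^sub>F s in at_right 0. (a s - a 0) / s * ((b s - b 0) / s) = 0"
      using near by eventually_elim (use d(2) z in auto)
    then have "((\<lambda>s. (a s - a 0) / s * ((b s - b 0) / s)) \<longlongrightarrow> 0) (at_right 0)" by (rule tendsto_eventually)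
    then have 3: "a' * b' = 0" using tendsto_mult[OF qa qb] by (meson tendsto_unique trivial_limit_at_right_real)
    show "a' \<ge> 0 \<and> b' \<ge> 0 \<and> a' * b' = 0" using 1 2 3 by blast
  }
qed

text \<open>The curve is read in tubular coordinates, where the folding is the cross of two half
  axes times the crease. The coordinates of the derivative are then constrained by
  \<open>derivative_of_quadrant_cross\<close>.\<close>

lemma right_tangent_frame_map:
  assumes U: "open U" "inj_on (frame_map p u v) U" "X \<in> U"
    and der: "\<And>Y. Y \<in> U \<Longrightarrow> (p has_vector_derivative p' (Y$1)) (at (Y$1))"
      "\<And>Y. Y \<in> U \<Longrightarrow> (u has_vector_derivative u' (Y$1)) (at (Y$1))"
      "\<And>Y. Y \<in> U \<Longrightarrow> (v has_vector_derivative v' (Y$1)) (at (Y$1))"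
    and nz: "(p' (X$1) + X$2 *\<^sub>R u' (X$1) + X$3 *\<^sub>R v' (X$1)) \<bullet> cross3 (u (X$1)) (v (X$1)) \<noteq> 0"
    and P: "P \<subseteq> frame_map p u v ` {Y \<in> U. Y$2 \<ge> 0 \<and> Y$3 \<ge> 0 \<and> Y$2 * Y$3 = 0}"
    and w: "right_tangent P (frame_map p u v X) w"
  obtains Y :: "real^3" where
    "w = Y$1 *\<^sub>R (p' (X$1) + X$2 *\<^sub>R u' (X$1) + X$3 *\<^sub>R v' (X$1)) + Y$2 *\<^sub>R u (X$1) + Y$3 *\<^sub>R v (X$1)"
    "X$2 > 0 \<Longrightarrow> Y$3 = 0" "X$3 > 0 \<Longrightarrow> Y$2 = 0"
    "X$2 = 0 \<Longrightarrow> X$3 = 0 \<Longrightarrow> Y$2 \<ge> 0 \<and> Y$3 \<ge> 0 \<and> Y$2 * Y$3 = 0"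
proof -
  let ?F = "frame_map p u v"
  define D where "D X Z = Z$1 *\<^sub>R (p' (X$1) + X$2 *\<^sub>R u' (X$1) + X$3 *\<^sub>R v' (X$1)) + Z$2 *\<^sub>R u (X$1) + Z$3 *\<^sub>R v (X$1)"
    for X Z :: "real^3"
  have derF: "(?F has_derivative D Y) (at Y)" if "Y \<in> U" for Y
    unfolding D_def by (rule frame_map_has_derivative) (use der that in auto)
  have lin: "linear (D X)" and "inj (D X)"
    using triple_map_linear_inj[OF nz] unfolding D_def[abs_def] .
  then obtain G where G: "linear G" "\<And>z. D X (G z) = z"
    using linear_injective_isomorphism[OF lin] by blast
  define g where "g = inv_into U ?F"
  have gF: "g (?F Y) = Y" if "Y \<in> U" for Y using U(2) that by (simp add: g_def)
  \<comment> \<open>The inverse is differentiated at this single point only, so a constant family of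
    inverse derivatives is enough.\<close>
  have derg: "(g has_derivative G) (at (?F X))"
    using has_derivative_inverse_on[where g' = "\<lambda>_. G", OF U(1) derF gF _ U(3)] G(2) by (auto simp: o_def id_def)
  obtain \<gamma> d where \<gamma>: "\<gamma> 0 = ?F X" "(\<gamma> has_vector_derivative w) (at 0 within {0..})" "d > 0"
      "\<forall>s\<in>{0..<d}. \<gamma> s \<in> P"
    using w unfolding right_tangent_def by blast
  define \<zeta> where "\<zeta> s = g (\<gamma> s)" for s
  have \<zeta>0: "\<zeta> 0 = X" by (simp add: \<zeta>_def \<gamma>(1) gF U(3))
  have "((\<lambda>s. g (\<gamma> s)) has_derivative (\<lambda>s. G (s *\<^sub>R w))) (at 0 within {0..})"
    using has_derivative_compose[of \<gamma> "\<lambda>s. s *\<^sub>R w" 0 "{0..}" g G] \<gamma>(1,2) derg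
    unfolding has_vector_derivative_def by simp
  then have "(\<zeta> has_vector_derivative G w) (at 0 within {0..})"
    unfolding has_vector_derivative_def \<zeta>_def[abs_def] by (simp add: linear_scale[OF G(1)])
  then have comp: "((\<lambda>s. \<zeta> s $ i) has_vector_derivative G w $ i) (at 0 within {0..})" for i :: 3
    by (rule bounded_linear.has_vector_derivative[OF bounded_linear_vec_nth])
  have mem: "\<zeta> s $ 2 \<ge> 0 \<and> \<zeta> s $ 3 \<ge> 0 \<and> \<zeta> s $ 2 * \<zeta> s $ 3 = 0" if s: "0 \<le> s" "s < d" for s
  proof -
    have "\<gamma> s \<in> ?F ` {Y \<in> U. Y$2 \<ge> 0 \<and> Y$3 \<ge> 0 \<and> Y$2 * Y$3 = 0}"
      using s \<gamma>(4) by (intro subsetD[OF P]) auto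
    then obtain Y where "Y \<in> U" "Y$2 \<ge> 0 \<and> Y$3 \<ge> 0 \<and> Y$2 * Y$3 = 0" "\<gamma> s = ?F Y"
      by blast
    then show ?thesis by (simp add: \<zeta>_def gF)
  qed
  show ?thesis
  proof (rule that[of "G w"])
    show "w = G w $ 1 *\<^sub>R (p' (X$1) + X$2 *\<^sub>R u' (X$1) + X$3 *\<^sub>R v' (X$1)) + G w $ 2 *\<^sub>R u (X$1) + G w $ 3 *\<^sub>R v (X$1)"
      using G(2)[of w] by (simp add: D_def)
    show "G w $ 3 = 0" if "X$2 > 0"
      using derivative_of_quadrant_cross(1)[OF comp comp \<gamma>(3) mem] that \<zeta>0 by simp
    show "G w $ 2 = 0" if "X$3 > 0"
      using derivative_of_quadrant_cross(1)[OF comp[of 3] comp[of 2] \<gamma>(3)] mem that \<zeta>0 by (simp add: mult.commute)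
    show "G w $ 2 \<ge> 0 \<and> G w $ 3 \<ge> 0 \<and> G w $ 2 * G w $ 3 = 0" if "X$2 = 0" "X$3 = 0"
      using derivative_of_quadrant_cross(2)[OF comp comp \<gamma>(3) mem] that \<zeta>0 by simp
  qed
qed

section \<open>The Frenet frame of the crease\<close>

text \<open>Frenet vectors of \<open>c0\<close> in closed form: derivatives and products become
  rational identities in t and sqrt 2. \<open>frenet_c0\<close> and \<open>frenet_c0s\<close>
  identify them.\<close>

definition frame_e :: "real \<Rightarrow> real^3" where
  "frame_e t = vector [1 / (1 + t\<^sup>2), sqrt 2 * t / (1 + t\<^sup>2), t\<^sup>2 / (1 + t\<^sup>2)]"

definition frame_n :: "real \<Rightarrow> real^3" where
  "frame_n t = vector [- (sqrt 2 * t) / (1 + t\<^sup>2), (1 - t\<^sup>2) / (1 + t\<^sup>2), sqrt 2 * t / (1 + t\<^sup>2)]"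

definition frame_b :: "real \<Rightarrow> real^3" where
  "frame_b t = vector [t\<^sup>2 / (1 + t\<^sup>2), - (sqrt 2 * t) / (1 + t\<^sup>2), 1 / (1 + t\<^sup>2)]"

definition frame_k :: "real \<Rightarrow> real" where
  "frame_k t = sqrt 2 / (1 + t\<^sup>2)"

lemma one_plus_square_pos: "0 < 1 + (t::real)\<^sup>2" "1 + (t::real)\<^sup>2 \<noteq> 0" "1 + t * t \<noteq> 0"
  using zero_le_power2[of t] by (simp_all add: add_pos_nonneg add_nonneg_eq_0_iff power2_eq_square)

lemma has_vector_derivative_vector3:
  assumes "(f has_field_derivative f') (at t)" "(g has_field_derivative g') (at t)" "(h has_field_derivative h') (at t)"
  shows "((\<lambda>t. vector [f t, g t, h t] :: real^3) has_vector_derivative vector [f', g', h']) (at t)"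
proof -
  have eq: "vector [a,b,c] = a *\<^sub>R axis 1 1 + b *\<^sub>R axis 2 1 + c *\<^sub>R (axis 3 1 :: real^3)" for a b c :: real
    by (simp add: vec_eq_iff forall_3 axis_def)
  show ?thesis unfolding eq
    by (auto intro!: derivative_eq_intros assms)
qed

lemma c0_has_vector_derivative: "(c0 has_vector_derivative frame_e t) (at t)"
proof -
  note [simp] = one_plus_square_pos
  have "((\<lambda>t. vector [arctan t, (1 / sqrt 2) * ln (1 + t\<^sup>2), t - arctan t] :: real^3) has_vector_derivative frame_e t) (at t)"
    unfolding frame_e_def
    by (rule has_vector_derivative_vector3; (rule derivative_eq_intros refl | simp)+;
        simp add: divide_simps power2_eq_square)
  then show ?thesis unfolding c0_def[abs_def] .
qed

lemma frame_e_has_vector_derivative: "(frame_e has_vector_derivative (frame_k t *\<^sub>R frame_n t)) (at t)"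
proof -
  note [simp] = one_plus_square_pos
  have eq: "frame_k t *\<^sub>R frame_n t = vector [- 2 * t / (1 + t\<^sup>2)\<^sup>2, sqrt 2 * (1 - t\<^sup>2) / (1 + t\<^sup>2)\<^sup>2, 2 * t / (1 + t\<^sup>2)\<^sup>2]"
    by (simp add: vec_eq_iff forall_3 frame_k_def frame_n_def power2_eq_square)
  show ?thesis
    unfolding frame_e_def[abs_def] eq
    by (rule has_vector_derivative_vector3; (rule derivative_eq_intros refl | simp)+;
        simp add: divide_simps power2_eq_square; simp add: algebra_simps)
qed

lemma frame_n_has_vector_derivative: "(frame_n has_vector_derivative (frame_k t *\<^sub>R (frame_b t - frame_e t))) (at t)"
proof -
  note [simp] = one_plus_square_pos
  have eq: "frame_k t *\<^sub>R (frame_b t - frame_e t) = vector [- sqrt 2 * (1 - t\<^sup>2) / (1 + t\<^sup>2)\<^sup>2, - 4 * t / (1 + t\<^sup>2)\<^sup>2, sqrt 2 * (1 - t\<^sup>2) / (1 + t\<^sup>2)\<^sup>2]"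
    by (simp add: vec_eq_iff forall_3 frame_k_def frame_e_def frame_b_def power2_eq_square)
       (simp add: divide_simps; simp add: algebra_simps)
  show ?thesis
    unfolding frame_n_def[abs_def] eq
    by (rule has_vector_derivative_vector3; (rule derivative_eq_intros refl | simp)+;
        simp add: divide_simps power2_eq_square; simp add: algebra_simps)
qed

lemma frame_b_has_vector_derivative: "(frame_b has_vector_derivative (- frame_k t *\<^sub>R frame_n t)) (at t)"
proof -
  note [simp] = one_plus_square_pos
  have eq: "- frame_k t *\<^sub>R frame_n t = vector [2 * t / (1 + t\<^sup>2)\<^sup>2, - (sqrt 2 * (1 - t\<^sup>2)) / (1 + t\<^sup>2)\<^sup>2, - 2 * t / (1 + t\<^sup>2)\<^sup>2]"
    by (simp add: vec_eq_iff forall_3 frame_k_def frame_n_def power2_eq_square)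
  show ?thesis
    unfolding frame_b_def[abs_def] eq
    by (rule has_vector_derivative_vector3; (rule derivative_eq_intros refl | simp)+;
        simp add: divide_simps power2_eq_square; simp add: algebra_simps)
qed

lemma frame_e_inner: "frame_e t \<bullet> frame_e s = (1 + t * s)\<^sup>2 / ((1 + t\<^sup>2) * (1 + s\<^sup>2))"
  by (simp add: inner_vec_def sum_3 frame_e_def one_plus_square_pos divide_simps power2_eq_square) (simp add: algebra_simps)

lemma frame_orthonormal:
  "frame_e t \<bullet> frame_e t = 1" "frame_n t \<bullet> frame_n t = 1" "frame_b t \<bullet> frame_b t = 1"
  "frame_e t \<bullet> frame_n t = 0" "frame_e t \<bullet> frame_b t = 0" "frame_n t \<bullet> frame_b t = 0"
  "frame_n t \<bullet> frame_e t = 0" "frame_b t \<bullet> frame_e t = 0" "frame_b t \<bullet> frame_n t = 0"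
  by (simp_all add: inner_vec_def sum_3 frame_e_def frame_n_def frame_b_def one_plus_square_pos divide_simps power2_eq_square)
     (simp_all add: algebra_simps)

lemma frame_cross: "cross3 (frame_e t) (frame_n t) = frame_b t"
  by (simp add: vec_eq_iff forall_3 cross3_def frame_e_def frame_n_def frame_b_def one_plus_square_pos divide_simps power2_eq_square)
     (simp add: algebra_simps)

lemma frame_k_pos: "frame_k t > 0"
  by (simp add: frame_k_def one_plus_square_pos)

lemma norm_frame: "norm (frame_e t) = 1" "norm (frame_n t) = 1" "norm (frame_b t) = 1"
  by (simp_all add: norm_eq_sqrt_inner frame_orthonormal)

lemma frenet_c0:
  "tangent c0 = frame_e" "accel c0 = (\<lambda>t. frame_k t *\<^sub>R frame_n t)" "curvature c0 = frame_k" "normal c0 = frame_n"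
  "binormal c0 = frame_b" "torsion c0 = frame_k"
proof -
  show t: "tangent c0 = frame_e"
    using c0_has_vector_derivative vector_derivative_at by (auto simp: tangent_def fun_eq_iff)
  show a: "accel c0 = (\<lambda>t. frame_k t *\<^sub>R frame_n t)"
    using frame_e_has_vector_derivative vector_derivative_at by (fastforce simp: accel_def t fun_eq_iff)
  show k: "curvature c0 = frame_k"
    using frame_k_pos by (auto simp: curvature_def a fun_eq_iff norm_frame less_imp_le)
  show n: "normal c0 = frame_n"
    using frame_k_pos by (auto simp: normal_def a k fun_eq_iff less_imp_neq[symmetric])
  show b: "binormal c0 = frame_b" by (simp add: binormal_def t n fun_eq_iff frame_cross)
  show "torsion c0 = frame_k"
    using vector_derivative_at[OF frame_n_has_vector_derivative]
    by (simp add: torsion_def b n fun_eq_iff frame_orthonormal inner_diff_left)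
qed

lemma has_vector_derivative_reflect:
  fixes f :: "real \<Rightarrow> 'a::real_normed_vector"
  assumes "(f has_vector_derivative f') (at (1 - t))"
  shows "((\<lambda>t. f (1 - t)) has_vector_derivative - f') (at t)"
proof -
  have "((\<lambda>t::real. 1 - t) has_vector_derivative - 1) (at t)"
    by (auto intro!: derivative_eq_intros)
  from vector_diff_chain_at[OF this, of f f'] assms show ?thesis by (simp add: o_def)
qed

text \<open>Each derivative contributes a sign under t -> 1 - t: tangent and binormal change sign,
  whereas normal, curvature and torsion do not.\<close>

lemma frenet_c0s:
  "tangent c0s = (\<lambda>t. - frame_e (1 - t))" "accel c0s = (\<lambda>t. frame_k (1 - t) *\<^sub>R frame_n (1 - t))"
  "curvature c0s = (\<lambda>t. frame_k (1 - t))" "normal c0s = (\<lambda>t. frame_n (1 - t))"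
  "binormal c0s = (\<lambda>t. - frame_b (1 - t))" "torsion c0s = (\<lambda>t. frame_k (1 - t))"
proof -
  show t: "tangent c0s = (\<lambda>t. - frame_e (1 - t))"
    using vector_derivative_at[OF has_vector_derivative_reflect[OF c0_has_vector_derivative]]
    by (auto simp: tangent_def fun_eq_iff c0s_def[abs_def])
  show a: "accel c0s = (\<lambda>t. frame_k (1 - t) *\<^sub>R frame_n (1 - t))"
    using vector_derivative_at[OF has_vector_derivative_minus[OF has_vector_derivative_reflect[OF frame_e_has_vector_derivative]]]
    by (auto simp: accel_def fun_eq_iff t)
  show k: "curvature c0s = (\<lambda>t. frame_k (1 - t))"
    using frame_k_pos by (auto simp: curvature_def a fun_eq_iff norm_frame less_imp_le)
  show n: "normal c0s = (\<lambda>t. frame_n (1 - t))"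
    using frame_k_pos by (auto simp: normal_def a k fun_eq_iff less_imp_neq[symmetric])
  show b: "binormal c0s = (\<lambda>t. - frame_b (1 - t))" by (simp add: binormal_def t n fun_eq_iff frame_cross)
  show "torsion c0s = (\<lambda>t. frame_k (1 - t))"
    using vector_derivative_at[OF has_vector_derivative_reflect[OF frame_n_has_vector_derivative]]
    by (simp add: torsion_def b n fun_eq_iff frame_orthonormal inner_diff_left inner_diff_right)
qed

lemma frame_C1:
  "frame_e C1_differentiable_on S" "frame_n C1_differentiable_on S" "frame_b C1_differentiable_on S"
proof -
  have "continuous_on S frame_k" by (auto simp: frame_k_def[abs_def] one_plus_square_pos intro!: continuous_intros)
  moreover have "continuous_on S frame_e" "continuous_on S frame_n" "continuous_on S frame_b"
    by (meson continuous_at_imp_continuous_on has_vector_derivative_continuous frame_e_has_vector_derivative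
        frame_n_has_vector_derivative frame_b_has_vector_derivative)+
  ultimately have "continuous_on S (\<lambda>t. frame_k t *\<^sub>R frame_n t)" "continuous_on S (\<lambda>t. frame_k t *\<^sub>R (frame_b t - frame_e t))"
    "continuous_on S (\<lambda>t. - frame_k t *\<^sub>R frame_n t)"
    by (auto intro!: continuous_intros)
  then show "frame_e C1_differentiable_on S" "frame_n C1_differentiable_on S" "frame_b C1_differentiable_on S"
    using frame_e_has_vector_derivative frame_n_has_vector_derivative frame_b_has_vector_derivative
    unfolding C1_differentiable_on_def by fast+
qed

definition fold_dir :: "(real \<Rightarrow> real) \<Rightarrow> (real \<Rightarrow> real) \<Rightarrow> (real \<Rightarrow> real) \<Rightarrow> real \<Rightarrow> real^3" where
  "fold_dir x A B t = x t *\<^sub>R frame_e t + A t *\<^sub>R frame_n t + B t *\<^sub>R frame_b t"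

lemma fold_dir_C1:
  assumes "x C1_differentiable_on S" "A C1_differentiable_on S" "B C1_differentiable_on S"
  shows "fold_dir x A B C1_differentiable_on S"
  unfolding fold_dir_def[abs_def] by (intro C1_differentiable_on_add C1_differentiable_on_scaleR assms frame_C1)

lemma fold_dir_triple: "frame_e t \<bullet> cross3 (fold_dir x A B t) (fold_dir y C D t) = A t * D t - B t * C t"
proof -
  have "cross3 (frame_e t) (frame_b t) = - frame_n t" "cross3 (frame_n t) (frame_b t) = frame_e t"
    by (simp_all add: vec_eq_iff forall_3 cross3_def frame_e_def frame_n_def frame_b_def one_plus_square_pos divide_simps power2_eq_square)
     (simp_all add: algebra_simps)
  moreover have "cross3 (frame_n t) (frame_e t) = - frame_b t" "cross3 (frame_b t) (frame_e t) = - cross3 (frame_e t) (frame_b t)" "cross3 (frame_b t) (frame_n t) = - cross3 (frame_n t) (frame_b t)"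
    using cross_skew frame_cross by metis+
  ultimately show ?thesis
    by (simp add: fold_dir_def cross_add_left cross_add_right cross_mult_left cross_mult_right frame_cross
        frame_orthonormal inner_add_right inner_diff_right)
qed

text \<open>This is \<open>frame_e t + frame_b t\<close> for every t. The sum is constant because
  its derivative is (curvature - torsion) times the normal, and the two functions coincide.\<close>

definition axis0 :: "real^3" where "axis0 = vector [1, 0, 1]"

lemma axis0_c0: "axis0 \<bullet> c0 t = t" "axis0 \<bullet> frame_e t = 1"
  by (simp_all add: axis0_def c0_def frame_e_def inner_vec_def sum_3 add_divide_distrib[symmetric] one_plus_square_pos)

lemma inj_c0: "inj_on c0 S"
  by (rule inj_onI) (metis axis0_c0(1))

text \<open>After clearing the denominator 1 + t^2 the inner product is a quadratic polynomial in t;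
  vanishing at three points kills its coefficients.\<close>

lemma frame_e_span:
  assumes "\<And>t. 1/10 < t \<Longrightarrow> t < 9/10 \<Longrightarrow> x \<bullet> frame_e t = 0"
  shows "x = 0"
proof -
  have eq: "(x$1 + sqrt 2 * t * x$2 + t\<^sup>2 * x$3) = 0" if "1/10 < t" "t < 9/10" for t
  proof -
    have "(1 + t\<^sup>2) * (x \<bullet> frame_e t) = x$1 + sqrt 2 * t * x$2 + t\<^sup>2 * x$3"
      by (simp add: frame_e_def inner_vec_def sum_3 one_plus_square_pos divide_simps)
    then show ?thesis using assms[OF that] by simp
  qed
  \<comment> \<open>Absorbing sqrt 2 leaves a linear system with rational coefficients.\<close>
  define z where "z = sqrt 2 * x$2"
  have "x$1 + t * z + t\<^sup>2 * x$3 = 0" if "1/10 < t" "t < 9/10" for t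
    using eq[OF that] by (simp add: z_def algebra_simps)
  from this[of "1/5"] this[of "1/2"] this[of "4/5"]
  have "x$1 = 0" "z = 0" "x$3 = 0" by (simp_all add: power2_eq_square)
  then show ?thesis by (simp add: z_def vec_eq_iff forall_3)
qed

section \<open>Rigidity of foldings along the crease\<close>

text \<open>The sets \<open>P \<epsilon>\<close> are curved foldings with crease \<open>c0\<close>: two strips leave the crease in the directions
  \<open>u\<close> and \<open>v\<close>, whose components orthogonal to the crease are \<open>A n + B b\<close> and \<open>- A n + B b\<close>.
  Rulings are normalised by their component orthogonal to the crease, which is why the strips are only
  required to contain some positive multiple of \<open>u\<close> and \<open>v\<close>.\<close>

definition crossed_fold :: "(real \<Rightarrow> (real^3) set) \<Rightarrow> (real \<Rightarrow> real) \<Rightarrow> (real \<Rightarrow> real) \<Rightarrow> bool" where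
  "crossed_fold P A B \<longleftrightarrow>
     (\<forall>t\<in>I0. A t > 0 \<and> B t \<noteq> 0 \<and> (A t)\<^sup>2 + (B t)\<^sup>2 = 1) \<and>
     (\<exists>u v. u C1_differentiable_on {0<..<1} \<and> v C1_differentiable_on {0<..<1} \<and>
       (\<forall>t\<in>I0. u t \<bullet> frame_n t = A t \<and> u t \<bullet> frame_b t = B t \<and> v t \<bullet> frame_n t = - A t \<and> v t \<bullet> frame_b t = B t) \<and>
       (\<forall>\<epsilon>. P \<epsilon> \<subseteq> {c0 t + a *\<^sub>R u t + b *\<^sub>R v t | t a b. t \<in> I0 \<and> 0 \<le> a \<and> a < \<epsilon> \<and> 0 \<le> b \<and> b < \<epsilon> \<and> a * b = 0}) \<and>
       (\<forall>\<epsilon>>0. \<forall>t\<in>I0. c0 t \<in> P \<epsilon> \<and>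
          (\<exists>k>0. \<forall>s. 0 \<le> s \<and> s < \<epsilon> \<longrightarrow> c0 t + s *\<^sub>R (k *\<^sub>R u t) \<in> P \<epsilon>) \<and>
          (\<exists>k>0. \<forall>s. 0 \<le> s \<and> s < \<epsilon> \<longrightarrow> c0 t + s *\<^sub>R (k *\<^sub>R v t) \<in> P \<epsilon>)))"

text \<open>The remainder is orthogonal to the three frame vectors, but these span the space, so it
  is orthogonal to itself.\<close>

lemma frame_expansion: "w = (w \<bullet> frame_e t) *\<^sub>R frame_e t + (w \<bullet> frame_n t) *\<^sub>R frame_n t + (w \<bullet> frame_b t) *\<^sub>R frame_b t"
proof -
  define z where "z = w - ((w \<bullet> frame_e t) *\<^sub>R frame_e t + (w \<bullet> frame_n t) *\<^sub>R frame_n t + (w \<bullet> frame_b t) *\<^sub>R frame_b t)"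
  have o: "z \<bullet> frame_e t = 0" "z \<bullet> frame_n t = 0" "z \<bullet> frame_b t = 0"
    by (simp_all add: z_def inner_diff_left inner_add_left frame_orthonormal)
  have "cross3 (frame_n t) (frame_b t) = frame_e t" 
    by (simp add: vec_eq_iff forall_3 cross3_def frame_e_def frame_n_def frame_b_def one_plus_square_pos divide_simps power2_eq_square)
     (simp add: algebra_simps)
  then have "frame_e t \<bullet> cross3 (frame_n t) (frame_b t) \<noteq> 0" by (simp add: frame_orthonormal)
  note lin_inj = triple_map_linear_inj[OF this]
  let ?f = "\<lambda>Z::real^3. Z$1 *\<^sub>R frame_e t + Z$2 *\<^sub>R frame_n t + Z$3 *\<^sub>R frame_b t"
  obtain Z where Z: "z = ?f Z"
    using linear_injective_imp_surjective[OF lin_inj refl] by (rule surjE)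
  have "z \<bullet> ?f Z = 0" by (simp add: inner_add_right o)
  then have "z \<bullet> z = 0" by (subst (2) Z)
  then show ?thesis by (simp add: z_def)
qed

lemma frame_determinant:
  assumes "u \<bullet> frame_n t = A" "u \<bullet> frame_b t = B" "v \<bullet> frame_n t = C" "v \<bullet> frame_b t = D"
  shows "frame_e t \<bullet> cross3 u v = A * D - B * C"
  using fold_dir_triple[of t "\<lambda>_. u \<bullet> frame_e t" "\<lambda>_. A" "\<lambda>_. B" "\<lambda>_. v \<bullet> frame_e t" "\<lambda>_. C" "\<lambda>_. D"]
    frame_expansion[of u t] frame_expansion[of v t] assms
  by (simp add: fold_dir_def)

lemma crossed_fold_coefficients:
  assumes "crossed_fold P A B" "t \<in> I0"
  shows "A t > 0 \<and> B t \<noteq> 0 \<and> (A t)\<^sup>2 + (B t)\<^sup>2 = 1"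
  using assms unfolding crossed_fold_def by (elim conjE) (erule bspec)

lemma crossed_foldE:
  assumes "crossed_fold P A B"
  obtains u v where "u C1_differentiable_on {0<..<1}" "v C1_differentiable_on {0<..<1}"
    "\<forall>t\<in>I0. u t \<bullet> frame_n t = A t \<and> u t \<bullet> frame_b t = B t \<and> v t \<bullet> frame_n t = - A t \<and> v t \<bullet> frame_b t = B t"
    "\<forall>\<epsilon>. P \<epsilon> \<subseteq> {c0 t + a *\<^sub>R u t + b *\<^sub>R v t | t a b. t \<in> I0 \<and> 0 \<le> a \<and> a < \<epsilon> \<and> 0 \<le> b \<and> b < \<epsilon> \<and> a * b = 0}"
    "\<forall>\<epsilon>>0. \<forall>t\<in>I0. c0 t \<in> P \<epsilon> \<and>
          (\<exists>k>0. \<forall>s. 0 \<le> s \<and> s < \<epsilon> \<longrightarrow> c0 t + s *\<^sub>R (k *\<^sub>R u t) \<in> P \<epsilon>) \<and>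
          (\<exists>k>0. \<forall>s. 0 \<le> s \<and> s < \<epsilon> \<longrightarrow> c0 t + s *\<^sub>R (k *\<^sub>R v t) \<in> P \<epsilon>)"
  using assms unfolding crossed_fold_def by (elim conjE exE) (rule that)

lemma crossed_fold_crease:
  assumes "crossed_fold P A B" "0 < \<epsilon>" "t \<in> I0"
  shows "c0 t \<in> P \<epsilon>"
  using assms by (elim crossed_foldE) simp

text \<open>An upper bound for the tangent vectors of the containing fold. The two alternatives are
  a point off the crease, where they lie in a plane with normal \<nu>, and a crease point, where
  their normal-plane part is a(A, B) or b(-A, B) and the component along the crease is free.\<close>

lemma crossed_fold_tangents:
  assumes "crossed_fold P A B"
  shows "\<exists>\<epsilon>0>0. \<forall>\<epsilon>. \<epsilon> \<le> \<epsilon>0 \<longrightarrow> (\<forall>q\<in>P \<epsilon>.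
    (\<exists>\<nu>. \<nu> \<noteq> 0 \<and> (\<forall>w. right_tangent (P \<epsilon>) q w \<longrightarrow> \<nu> \<bullet> w = 0)) \<or>
    (\<exists>s\<in>I0. q = c0 s \<and> (\<forall>w. right_tangent (P \<epsilon>) q w \<longrightarrow>
        (\<exists>a b. 0 \<le> a \<and> 0 \<le> b \<and> a * b = 0 \<and> w \<bullet> frame_n s = (a - b) * A s \<and> w \<bullet> frame_b s = (a + b) * B s))))"
proof -
  have AB: "A t > 0 \<and> B t \<noteq> 0" if "t \<in> I0" for t
    using crossed_fold_coefficients[OF assms that] by simp
  obtain u v where uv: "u C1_differentiable_on {0<..<1}" "v C1_differentiable_on {0<..<1}"
    and comp': "\<forall>t\<in>I0. u t \<bullet> frame_n t = A t \<and> u t \<bullet> frame_b t = B t \<and> v t \<bullet> frame_n t = - A t \<and> v t \<bullet> frame_b t = B t"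
    and sub': "\<forall>\<epsilon>. P \<epsilon> \<subseteq> {c0 t + a *\<^sub>R u t + b *\<^sub>R v t | t a b. t \<in> I0 \<and> 0 \<le> a \<and> a < \<epsilon> \<and> 0 \<le> b \<and> b < \<epsilon> \<and> a * b = 0}"
    using assms by (rule crossed_foldE)
  note comp = comp'[rule_format] and sub = sub'[rule_format]
  obtain u' v' where u': "\<And>t. t \<in> {0<..<1} \<Longrightarrow> (u has_vector_derivative u' t) (at t)" "continuous_on {0<..<1} u'"
    and v': "\<And>t. t \<in> {0<..<1} \<Longrightarrow> (v has_vector_derivative v' t) (at t)" "continuous_on {0<..<1} v'"
    using uv unfolding C1_differentiable_on_def by metis
  have I0: "compact I0" "I0 \<subseteq> {0<..<1}" by (auto simp: I0_def)
  have cfe: "continuous_on {0<..<1} frame_e"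
    by (meson continuous_at_imp_continuous_on has_vector_derivative_continuous frame_e_has_vector_derivative)
  \<comment> \<open>With components (A, B) and (-A, B) the determinant is 2AB.\<close>
  have det: "frame_e t \<bullet> cross3 (u t) (v t) \<noteq> 0" if "t \<in> I0" for t
    using frame_determinant[of "u t" t "A t" "B t" "v t" "- A t" "B t"] comp[OF that] AB[OF that] by simp
  obtain U e where U: "open U" "e > 0" "inj_on (frame_map c0 u v) U"
    "\<And>X. X \<in> U \<Longrightarrow> X$1 \<in> {0<..<1} \<and> (frame_e (X$1) + X$2 *\<^sub>R u' (X$1) + X$3 *\<^sub>R v' (X$1)) \<bullet> cross3 (u (X$1)) (v (X$1)) \<noteq> 0"
    "\<And>X. X$1 \<in> I0 \<Longrightarrow> \<bar>X$2\<bar> < e \<Longrightarrow> \<bar>X$3\<bar> < e \<Longrightarrow> X \<in> U"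
    using frame_map_tube[OF open_greaterThanLessThan I0(2,1) c0_has_vector_derivative cfe u' v' inj_c0 det]
    by blast
  show ?thesis
  proof (intro exI[of _ e] conjI allI impI ballI)
    fix \<epsilon> q assume \<epsilon>: "\<epsilon> \<le> e" and q: "q \<in> P \<epsilon>"
    have point: "\<exists>X. X \<in> U \<and> X$1 \<in> I0 \<and> X$2 \<ge> 0 \<and> X$3 \<ge> 0 \<and> X$2 * X$3 = 0 \<and> x = frame_map c0 u v X" if xP: "x \<in> P \<epsilon>" for x
    proof -
      obtain t a b where x: "x = c0 t + a *\<^sub>R u t + b *\<^sub>R v t" "t \<in> I0" "0 \<le> a" "a < \<epsilon>" "0 \<le> b" "b < \<epsilon>" "a * b = 0"
        using xP sub[of \<epsilon>] by blast
      define X where "X = (vector [t,a,b] :: real^3)"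
      have "X$1 = t" "X$2 = a" "X$3 = b" by (simp_all add: X_def)
      then show ?thesis using x \<epsilon> U(5)[of X] by (intro exI[of _ X]) (auto simp: frame_map_def)
    qed
    have P: "P \<epsilon> \<subseteq> frame_map c0 u v ` {Y \<in> U. Y$2 \<ge> 0 \<and> Y$3 \<ge> 0 \<and> Y$2 * Y$3 = 0}"
      using point by blast
    obtain X where X: "X \<in> U" "X$1 \<in> I0" "X$2 \<ge> 0" "X$3 \<ge> 0" "X$2 * X$3 = 0" "q = frame_map c0 u v X"
      using point[OF q] by blast
    define m where "m = frame_e (X$1) + X$2 *\<^sub>R u' (X$1) + X$3 *\<^sub>R v' (X$1)"
    have nz: "m \<bullet> cross3 (u (X$1)) (v (X$1)) \<noteq> 0" using U(4)[OF X(1)] by (simp add: m_def)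
    have tan: "\<exists>Y::real^3. w = Y$1 *\<^sub>R m + Y$2 *\<^sub>R u (X$1) + Y$3 *\<^sub>R v (X$1) \<and> (X$2 > 0 \<longrightarrow> Y$3 = 0) \<and> (X$3 > 0 \<longrightarrow> Y$2 = 0)
       \<and> (X$2 = 0 \<longrightarrow> X$3 = 0 \<longrightarrow> Y$2 \<ge> 0 \<and> Y$3 \<ge> 0 \<and> Y$2 * Y$3 = 0)" if "right_tangent (P \<epsilon>) q w" for w
      using right_tangent_frame_map[OF U(1,3) X(1) c0_has_vector_derivative u'(1) v'(1) nz[unfolded m_def] P that[unfolded X(6)]] U(4)
      unfolding m_def by (smt (verit))
    \<comment> \<open>Off the crease one strip is active, and the plane is spanned by m and the
      direction of that strip; its normal is their cross product.\<close>
    consider "X$2 > 0" | "X$3 > 0" | "X$2 = 0" "X$3 = 0" using X(3,4) by fastforce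
    then show "(\<exists>\<nu>. \<nu> \<noteq> 0 \<and> (\<forall>w. right_tangent (P \<epsilon>) q w \<longrightarrow> \<nu> \<bullet> w = 0)) \<or>
      (\<exists>s\<in>I0. q = c0 s \<and> (\<forall>w. right_tangent (P \<epsilon>) q w \<longrightarrow>
        (\<exists>a b. 0 \<le> a \<and> 0 \<le> b \<and> a * b = 0 \<and> w \<bullet> frame_n s = (a - b) * A s \<and> w \<bullet> frame_b s = (a + b) * B s)))"
    proof cases
      case 1
      have "cross3 m (u (X$1)) \<bullet> w = 0" if w: "right_tangent (P \<epsilon>) q w" for w
      proof -
        obtain Y :: "real^3" where "w = Y$1 *\<^sub>R m + Y$2 *\<^sub>R u (X$1) + Y$3 *\<^sub>R v (X$1)" "Y$3 = 0"
          using tan[OF w] 1 by blast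
        then show ?thesis by (simp add: inner_add_right dot_cross_self inner_commute)
      qed
      moreover have "cross3 m (u (X$1)) \<noteq> 0" using nz by (metis cross_triple inner_commute inner_zero_right)
      ultimately show ?thesis by blast
    next
      case 2
      have "cross3 m (v (X$1)) \<bullet> w = 0" if w: "right_tangent (P \<epsilon>) q w" for w
      proof -
        obtain Y :: "real^3" where "w = Y$1 *\<^sub>R m + Y$2 *\<^sub>R u (X$1) + Y$3 *\<^sub>R v (X$1)" "Y$2 = 0"
          using tan[OF w] 2 by blast
        then show ?thesis by (simp add: inner_add_right dot_cross_self inner_commute)
      qed
      moreover have "cross3 m (v (X$1)) \<noteq> 0"
      proof
        assume "cross3 m (v (X$1)) = 0"
        moreover have "m \<bullet> cross3 (u (X$1)) (v (X$1)) = - (cross3 m (v (X$1)) \<bullet> u (X$1))"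
          by (simp add: cross3_simps)
        ultimately show False using nz by simp
      qed
      ultimately show ?thesis by blast
    next
      case 3
      have "\<exists>a b. 0 \<le> a \<and> 0 \<le> b \<and> a * b = 0 \<and> w \<bullet> frame_n (X$1) = (a - b) * A (X$1) \<and> w \<bullet> frame_b (X$1) = (a + b) * B (X$1)"
        if w: "right_tangent (P \<epsilon>) q w" for w
      proof -
        obtain Y :: "real^3" where Y: "w = Y$1 *\<^sub>R frame_e (X$1) + Y$2 *\<^sub>R u (X$1) + Y$3 *\<^sub>R v (X$1)"
            "Y$2 \<ge> 0 \<and> Y$3 \<ge> 0 \<and> Y$2 * Y$3 = 0"
          using tan[OF w] 3 by (auto simp: m_def)
        then show ?thesis using comp[OF X(2)]
          by (intro exI[of _ "Y$2"] exI[of _ "Y$3"]) (simp add: inner_add_left frame_orthonormal algebra_simps)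
      qed
      then show ?thesis using 3 X(2,6) by (auto simp: frame_map_def)
    qed
  qed (rule U(2))
qed

text \<open>The matching lower bound, for the contained fold. The parameter is interior so that the
  crease can be followed both ways. Together with the two ruling directions the tangent vectors lie
  in no plane, so such a point cannot be sent off the crease.\<close>

lemma crossed_fold_has_tangents:
  assumes "crossed_fold P A B" "0 < \<delta>" "1/10 < t" "t < 9/10"
  shows "right_tangent (P \<delta>) (c0 t) (frame_e t)" "right_tangent (P \<delta>) (c0 t) (- frame_e t)"
    and "\<exists>k w w'. 0 < k \<and> right_tangent (P \<delta>) (c0 t) w \<and> right_tangent (P \<delta>) (c0 t) w' \<and>
      w \<bullet> frame_n t = k * A t \<and> w \<bullet> frame_b t = k * B t \<and> (\<forall>\<nu>. \<nu> \<bullet> frame_e t = 0 \<and> \<nu> \<bullet> w = 0 \<and> \<nu> \<bullet> w' = 0 \<longrightarrow> \<nu> = 0)"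
proof -
  have t: "t \<in> I0" using assms by (auto simp: I0_def)
  note mem = crossed_fold_crease[OF assms(1,2)]
  have 1: "((\<lambda>s. c0 (t + \<sigma> * s)) has_vector_derivative (\<sigma> *\<^sub>R frame_e t)) (at 0 within {0..})" for \<sigma>
  proof -
    have "((\<lambda>s. t + \<sigma> * s) has_vector_derivative \<sigma>) (at 0)"
      unfolding has_real_derivative_iff_has_vector_derivative[symmetric] by (auto intro!: derivative_eq_intros)
    from vector_diff_chain_at[OF this, of c0 "frame_e t"] c0_has_vector_derivative[of t]
    show ?thesis by (auto simp: o_def intro: has_vector_derivative_at_within)
  qed
  show "right_tangent (P \<delta>) (c0 t) (frame_e t)"
    unfolding right_tangent_def using 1[of 1] mem assms(3,4)
    by (intro exI[of _ "\<lambda>s. c0 (t + 1 * s)"] conjI exI[of _ "9/10 - t"]) (auto simp: I0_def)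
  show "right_tangent (P \<delta>) (c0 t) (- frame_e t)"
    unfolding right_tangent_def using 1[of "-1"] mem assms(3,4)
    by (intro exI[of _ "\<lambda>s. c0 (t + (-1) * s)"] conjI exI[of _ "t - 1/10"]) (auto simp: I0_def)
  have AB: "A t > 0 \<and> B t \<noteq> 0" using crossed_fold_coefficients[OF assms(1) t] by simp
  obtain u v k l where comp: "u t \<bullet> frame_n t = A t \<and> u t \<bullet> frame_b t = B t \<and> v t \<bullet> frame_n t = - A t \<and> v t \<bullet> frame_b t = B t"
    and k: "k > 0" "\<And>s. 0 \<le> s \<Longrightarrow> s < \<delta> \<Longrightarrow> c0 t + s *\<^sub>R (k *\<^sub>R u t) \<in> P \<delta>"
    and l: "l > 0" "\<And>s. 0 \<le> s \<Longrightarrow> s < \<delta> \<Longrightarrow> c0 t + s *\<^sub>R (l *\<^sub>R v t) \<in> P \<delta>"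
  proof -
    obtain u v where u: "\<forall>t\<in>I0. u t \<bullet> frame_n t = A t \<and> u t \<bullet> frame_b t = B t \<and> v t \<bullet> frame_n t = - A t \<and> v t \<bullet> frame_b t = B t"
      and "\<forall>\<epsilon>>0. \<forall>t\<in>I0. c0 t \<in> P \<epsilon> \<and>
          (\<exists>k>0. \<forall>s. 0 \<le> s \<and> s < \<epsilon> \<longrightarrow> c0 t + s *\<^sub>R (k *\<^sub>R u t) \<in> P \<epsilon>) \<and>
          (\<exists>k>0. \<forall>s. 0 \<le> s \<and> s < \<epsilon> \<longrightarrow> c0 t + s *\<^sub>R (k *\<^sub>R v t) \<in> P \<epsilon>)"
      using assms(1) by (rule crossed_foldE)
    from this(2)[rule_format, OF assms(2) t] obtain k l where
      "k > 0" "\<And>s. 0 \<le> s \<Longrightarrow> s < \<delta> \<Longrightarrow> c0 t + s *\<^sub>R (k *\<^sub>R u t) \<in> P \<delta>"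
      "l > 0" "\<And>s. 0 \<le> s \<Longrightarrow> s < \<delta> \<Longrightarrow> c0 t + s *\<^sub>R (l *\<^sub>R v t) \<in> P \<delta>"
      by blast
    with u[rule_format, OF t] show ?thesis by (rule that)
  qed
  show "\<exists>k w w'. 0 < k \<and> right_tangent (P \<delta>) (c0 t) w \<and> right_tangent (P \<delta>) (c0 t) w' \<and>
      w \<bullet> frame_n t = k * A t \<and> w \<bullet> frame_b t = k * B t \<and> (\<forall>\<nu>. \<nu> \<bullet> frame_e t = 0 \<and> \<nu> \<bullet> w = 0 \<and> \<nu> \<bullet> w' = 0 \<longrightarrow> \<nu> = 0)"
  proof (rule exI[of _ k], rule exI[of _ "k *\<^sub>R u t"], rule exI[of _ "l *\<^sub>R v t"], intro conjI allI impI)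
    show "right_tangent (P \<delta>) (c0 t) (k *\<^sub>R u t)" "right_tangent (P \<delta>) (c0 t) (l *\<^sub>R v t)"
      using right_tangent_segment[OF assms(2)] k l by blast+
    fix \<nu> assume \<nu>: "\<nu> \<bullet> frame_e t = 0 \<and> \<nu> \<bullet> (k *\<^sub>R u t) = 0 \<and> \<nu> \<bullet> (l *\<^sub>R v t) = 0"
    then have z: "\<nu> \<bullet> u t = 0" "\<nu> \<bullet> v t = 0" using k l by auto
    have ex: "\<nu> \<bullet> x = (\<nu> \<bullet> frame_e t) * (x \<bullet> frame_e t) + (\<nu> \<bullet> frame_n t) * (x \<bullet> frame_n t) + (\<nu> \<bullet> frame_b t) * (x \<bullet> frame_b t)" for x
      by (subst frame_expansion[of x t]) (simp add: inner_add_right mult.commute)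
    have "(\<nu> \<bullet> frame_n t) * A t + (\<nu> \<bullet> frame_b t) * B t = 0" "- (\<nu> \<bullet> frame_n t) * A t + (\<nu> \<bullet> frame_b t) * B t = 0"
      using ex[of "u t"] ex[of "v t"] z \<nu> comp by simp_all
    then have "(\<nu> \<bullet> frame_n t) * A t = 0" "(\<nu> \<bullet> frame_b t) * B t = 0" by linarith+
    then have "\<nu> \<bullet> frame_n t = 0" "\<nu> \<bullet> frame_b t = 0" using AB by auto
    then show "\<nu> = 0" using frame_expansion[of \<nu> t] \<nu> by simp
  qed (use k comp in auto)
qed

text \<open>The bound on \<epsilon> comes from the tubular coordinates of \<open>Q\<close> alone;
  for \<open>P\<close> tangent vectors are merely exhibited, and these exist for every positive
  \<delta>.\<close>

lemma fold_containment_rigid: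
  assumes P: "crossed_fold P A B" and Q: "crossed_fold Q C D"
  shows "\<exists>\<epsilon>0>0. \<forall>\<epsilon> \<delta> T. \<epsilon> \<le> \<epsilon>0 \<and> 0 < \<delta> \<and> isometry3 T \<and> T ` P \<delta> \<subseteq> Q \<epsilon> \<longrightarrow>
     A (1/5) = C (1/5) \<and> B (1/5) = D (1/5)"
proof -
  obtain \<epsilon>0 where \<epsilon>0: "\<epsilon>0 > 0" and cone: "\<And>\<epsilon> q. \<epsilon> \<le> \<epsilon>0 \<Longrightarrow> q \<in> Q \<epsilon> \<Longrightarrow>
    (\<exists>\<nu>. \<nu> \<noteq> 0 \<and> (\<forall>w. right_tangent (Q \<epsilon>) q w \<longrightarrow> \<nu> \<bullet> w = 0)) \<or>
    (\<exists>s\<in>I0. q = c0 s \<and> (\<forall>w. right_tangent (Q \<epsilon>) q w \<longrightarrow>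
        (\<exists>a b. 0 \<le> a \<and> 0 \<le> b \<and> a * b = 0 \<and> w \<bullet> frame_n s = (a - b) * C s \<and> w \<bullet> frame_b s = (a + b) * D s)))"
    using crossed_fold_tangents[OF Q] by blast
  note AB = crossed_fold_coefficients[OF P] and CD = crossed_fold_coefficients[OF Q]
  show ?thesis
  proof (intro exI[of _ \<epsilon>0] conjI allI impI \<epsilon>0)
    fix \<epsilon> \<delta> T
    assume "\<epsilon> \<le> \<epsilon>0 \<and> 0 < \<delta> \<and> isometry3 T \<and> T ` P \<delta> \<subseteq> Q \<epsilon>"
    then have h: "\<epsilon> \<le> \<epsilon>0" "0 < \<delta>" "isometry3 T" "T ` P \<delta> \<subseteq> Q \<epsilon>" by auto
    define L where "L x = T x - T 0" for x
    have ot: "orthogonal_transformation L"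
      unfolding orthogonal_transformation_isometry using h(3) by (auto simp: L_def isometry3_def dist_norm)
    have L: "linear L" "\<And>x y. L x \<bullet> L y = x \<bullet> y" using ot by (auto simp: orthogonal_transformation_def)
    have TL: "T x = T 0 + L x" for x by (simp add: L_def)
    have push: "right_tangent (Q \<epsilon>) (T (c0 t)) (L w)" if "right_tangent (P \<delta>) (c0 t) w" for t w
      using right_tangent_mono[OF right_tangent_isometry[OF that L(1) TL] h(4)] .
    have inQ: "T (c0 t) \<in> Q \<epsilon>" if "t \<in> I0" for t
      using crossed_fold_crease[OF P h(2) that] h(4) by blast
    have crease: "\<exists>s\<in>I0. T (c0 t) = c0 s \<and> (\<forall>w. right_tangent (Q \<epsilon>) (T (c0 t)) w \<longrightarrow>
        (\<exists>a b. 0 \<le> a \<and> 0 \<le> b \<and> a * b = 0 \<and> w \<bullet> frame_n s = (a - b) * C s \<and> w \<bullet> frame_b s = (a + b) * D s))"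
      if t: "1/10 < t" "t < 9/10" for t
    proof -
      have tI: "t \<in> I0" using t by (auto simp: I0_def)
      have "\<not> (\<exists>\<nu>. \<nu> \<noteq> 0 \<and> (\<forall>w. right_tangent (Q \<epsilon>) (T (c0 t)) w \<longrightarrow> \<nu> \<bullet> w = 0))"
      proof (intro notI, elim exE conjE)
        fix \<nu> assume \<nu>: "\<nu> \<noteq> 0" "\<forall>w. right_tangent (Q \<epsilon>) (T (c0 t)) w \<longrightarrow> \<nu> \<bullet> w = 0"
        obtain \<rho> where \<rho>: "L \<rho> = \<nu>" using orthogonal_transformation_surj[OF ot] by (metis surjD)
        have "\<rho> \<bullet> w = 0" if "right_tangent (P \<delta>) (c0 t) w" for w
          using \<nu>(2) push[OF that] L(2)[of \<rho> w] by (simp add: \<rho>)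
        then have "\<rho> = 0"
          using crossed_fold_has_tangents[OF P h(2) t] by blast
        then show False using \<nu>(1) \<rho> linear_0[OF L(1)] by simp
      qed
      then show ?thesis using cone[OF h(1) inQ[OF tI]] by blast
    qed
    have "\<exists>s \<sigma>. s \<in> I0 \<and> T (c0 t) = c0 s \<and> L (frame_e t) = \<sigma> *\<^sub>R frame_e s \<and> \<bar>\<sigma>\<bar> = 1" if t: "1/10 < t" "t < 9/10" for t
    proof -
      obtain s where s: "s \<in> I0" "T (c0 t) = c0 s" and c: "\<And>w. right_tangent (Q \<epsilon>) (T (c0 t)) w \<Longrightarrow>
        (\<exists>a b. 0 \<le> a \<and> 0 \<le> b \<and> a * b = 0 \<and> w \<bullet> frame_n s = (a - b) * C s \<and> w \<bullet> frame_b s = (a + b) * D s)"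
        using crease[OF t] by blast
      note tn = crossed_fold_has_tangents(1,2)[OF P h(2) t, THEN push]
      obtain a b where ab: "0 \<le> a" "0 \<le> b" "L (frame_e t) \<bullet> frame_n s = (a - b) * C s" "L (frame_e t) \<bullet> frame_b s = (a + b) * D s"
        using c[OF tn(1)] by blast
      obtain a' b' where ab': "0 \<le> a'" "0 \<le> b'" "L (- frame_e t) \<bullet> frame_b s = (a' + b') * D s"
        using c[OF tn(2)] by blast
      \<comment> \<open>Both the image of \<open>frame_e t\<close> and its negative are tangent, yet
        the binormal components of tangent vectors all have the sign of \<open>D s\<close> or
        vanish. Hence the image is parallel to the crease.\<close>
      have "(a + b + (a' + b')) * D s = 0"
        using ab(4) ab'(3) by (simp add: linear_neg[OF L(1)] algebra_simps)
      then have z: "a = 0" "b = 0" using CD[OF s(1)] ab ab' by auto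
      define \<sigma> where "\<sigma> = L (frame_e t) \<bullet> frame_e s"
      have e: "L (frame_e t) = \<sigma> *\<^sub>R frame_e s"
        using frame_expansion[of "L (frame_e t)" s] ab z by (simp add: \<sigma>_def)
      have "norm (L (frame_e t)) = 1" using orthogonal_transformation_norm[OF ot] norm_frame by metis
      then have "\<bar>\<sigma>\<bar> = 1" by (simp add: e norm_frame)
      then show ?thesis using s e by blast
    qed
    then obtain s \<sigma> where s\<sigma>: "\<And>t. 1/10 < t \<Longrightarrow> t < 9/10 \<Longrightarrow> s t \<in> I0 \<and> T (c0 t) = c0 (s t) \<and> L (frame_e t) = \<sigma> t *\<^sub>R frame_e (s t) \<and> \<bar>\<sigma> t\<bar> = 1"
      by metis
    define \<tau> where "\<tau> = \<sigma> (1/2)"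
    have \<tau>1: "\<bar>\<tau>\<bar> = 1" using s\<sigma>[of "1/2"] by (simp add: \<tau>_def)
    have const: "\<sigma> t = \<tau>" if t: "1/10 < t" "t < 9/10" for t
    proof -
      \<comment> \<open>Tangents at positive parameters form acute angles, so comparison with t =
        1/2 fixes the sign \<sigma> without any continuity argument for \<open>s\<close>.\<close>
      have pos: "frame_e x \<bullet> frame_e y > 0" if "x > 0" "y > 0" for x y
        using that by (simp add: frame_e_inner one_plus_square_pos add_pos_pos less_imp_neq[symmetric])
      have "frame_e t \<bullet> frame_e (1/2) = \<sigma> t * \<tau> * (frame_e (s t) \<bullet> frame_e (s (1/2)))"
        using L(2)[of "frame_e t" "frame_e (1/2)"] s\<sigma>[OF t] s\<sigma>[of "1/2"] by (simp add: \<tau>_def mult_ac)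
      moreover have "frame_e t \<bullet> frame_e (1/2) > 0" "frame_e (s t) \<bullet> frame_e (s (1/2)) > 0"
        using s\<sigma>[OF t] s\<sigma>[of "1/2"] t by (auto intro!: pos simp: I0_def)
      ultimately have "\<sigma> t * \<tau> > 0" by (metis zero_less_mult_pos2)
      then show ?thesis using s\<sigma>[OF t] \<tau>1 by (auto simp: abs_if zero_less_mult_iff split: if_splits)
    qed
    \<comment> \<open>The preimage of the axis has constant inner product \<tau> with all tangents,
      and so does \<open>\<tau> *\<^sub>R axis0\<close>; as the tangents span, the two
      agree.\<close>
    obtain \<rho> where \<rho>: "L \<rho> = axis0" using orthogonal_transformation_surj[OF ot] by (metis surjD)
    have "\<rho> - \<tau> *\<^sub>R axis0 = 0"
    proof (rule frame_e_span)
      fix t :: real assume t: "1/10 < t" "t < 9/10"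
      have "\<rho> \<bullet> frame_e t = axis0 \<bullet> L (frame_e t)" using L(2)[of \<rho> "frame_e t"] \<rho> by simp
      also have "\<dots> = \<tau>" using s\<sigma>[OF t] const[OF t] by (simp add: axis0_c0)
      finally show "(\<rho> - \<tau> *\<^sub>R axis0) \<bullet> frame_e t = 0" by (simp add: inner_diff_left axis0_c0)
    qed
    then have \<rho>': "\<rho> = \<tau> *\<^sub>R axis0" by simp
    define k where "k = axis0 \<bullet> T 0"
    \<comment> \<open>The parameter is the height along the axis, so the image parameter is affine
      in t. Mapping (1/10, 9/10) into \<open>I0\<close>, an interval of the same length, then forces
      k = 0 or, for \<tau> = -1, k = 1.\<close>
    have sk: "s t = k + \<tau> * t" if t: "1/10 < t" "t < 9/10" for t
    proof -
      have "s t = axis0 \<bullet> T (c0 t)" using s\<sigma>[OF t] by (simp add: axis0_c0)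
      also have "\<dots> = k + L \<rho> \<bullet> L (c0 t)" by (subst TL) (simp add: k_def inner_add_right \<rho>)
      also have "\<dots> = k + \<tau> * t" by (simp add: L(2) \<rho>' axis0_c0)
      finally show ?thesis .
    qed
    have bound: "1/10 \<le> k + \<tau> * t \<and> k + \<tau> * t \<le> 9/10" if "1/10 < t" "t < 9/10" for t
      using s\<sigma>[OF that] sk[OF that] by (simp add: I0_def)
    have \<tau>: "\<tau> = 1"
    proof (rule ccontr)
      assume "\<tau> \<noteq> 1"
      then have m: "\<tau> = -1" using \<tau>1 by (auto simp: abs_if split: if_splits)
      have "k \<le> 1"
      proof (rule field_le_epsilon)
        fix e :: real assume "e > 0"
        then obtain d where "0 < d" "d \<le> e" "d \<le> 1/10" by (meson field_lbound_gt_zero less_imp_le zero_less_divide_1_iff zero_less_numeral)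
        then show "k \<le> 1 + e" using bound[of "1/10 + d"] m by simp
      qed
      moreover have "k \<ge> 1"
      proof (rule field_le_epsilon)
        fix e :: real assume "e > 0"
        then obtain d where "0 < d" "d \<le> e" "d \<le> 1/10" by (meson field_lbound_gt_zero less_imp_le zero_less_divide_1_iff zero_less_numeral)
        then show "1 \<le> k + e" using bound[of "9/10 - d"] m by simp
      qed
      ultimately have k1: "k = 1" by simp
      \<comment> \<open>Reflection fixes 1/2 and swaps 1/5 with 4/5, but the two inner products are
        121/130 and 196/205.\<close>
      have "frame_e (1/5) \<bullet> frame_e (1/2) = frame_e (4/5) \<bullet> frame_e (1/2)"
        using L(2)[of "frame_e (1/5)" "frame_e (1/2)"] s\<sigma>[of "1/5"] s\<sigma>[of "1/2"] sk[of "1/5"] sk[of "1/2"] const[of "1/5"] const[of "1/2"]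
        by (simp add: k1 m)
      then show False by (simp add: frame_e_inner power2_eq_square)
    qed
    have k0: "k = 0"
    proof (rule antisym)
      show "k \<le> 0"
      proof (rule field_le_epsilon)
        fix e :: real assume "e > 0"
        then obtain d where "0 < d" "d \<le> e" "d \<le> 1/10" by (meson field_lbound_gt_zero less_imp_le zero_less_divide_1_iff zero_less_numeral)
        then show "k \<le> 0 + e" using bound[of "9/10 - d"] \<tau> by simp
      qed
      show "0 \<le> k"
      proof (rule field_le_epsilon)
        fix e :: real assume "e > 0"
        then obtain d where "0 < d" "d \<le> e" "d \<le> 1/10" by (meson field_lbound_gt_zero less_imp_le zero_less_divide_1_iff zero_less_numeral)
        then show "0 \<le> k + e" using bound[of "1/10 + d"] \<tau> by simp
      qed
    qed
    have Le: "L (frame_e t) = frame_e t" "T (c0 t) = c0 t" if t: "1/10 < t" "t < 9/10" for t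
      using s\<sigma>[OF t] const[OF t] sk[OF t] \<tau> k0 by simp_all
    have Lid: "L x = x" for x
    proof -
      have "L x - x = 0"
        by (rule frame_e_span) (use L(2) Le in \<open>metis inner_diff_left right_minus_eq\<close>)
      then show ?thesis by simp
    qed
    have t5: "1/10 < (1/5::real)" "1/5 < (9/10::real)" "1/5 \<in> I0" by (auto simp: I0_def)
    obtain s' where s': "T (c0 (1/5)) = c0 s'" and c: "\<And>w. right_tangent (Q \<epsilon>) (T (c0 (1/5))) w \<Longrightarrow>
        (\<exists>a b. 0 \<le> a \<and> 0 \<le> b \<and> a * b = 0 \<and> w \<bullet> frame_n s' = (a - b) * C s' \<and> w \<bullet> frame_b s' = (a + b) * D s')"
      using crease[OF t5(1,2)] by blast
    have s5: "s' = 1/5" using s' Le(2)[OF t5(1,2)] inj_c0[of UNIV] by (metis injD)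
    obtain r w where w: "0 < r" "right_tangent (P \<delta>) (c0 (1/5)) w" "w \<bullet> frame_n (1/5) = r * A (1/5)" "w \<bullet> frame_b (1/5) = r * B (1/5)"
      using crossed_fold_has_tangents(3)[OF P h(2) t5(1,2)] by blast
    obtain a b where ab: "0 \<le> a" "0 \<le> b" "a * b = 0" "r * A (1/5) = (a - b) * C (1/5)" "r * B (1/5) = (a + b) * D (1/5)"
      using c[OF push[OF w(2)]] w by (auto simp: s5 Lid)
    \<comment> \<open>Positivity of \<open>A\<close> and \<open>C\<close> selects the first half
      plane. The directions are then positively proportional, and unit length of (A, B) and (C, D)
      makes them equal.\<close>
    have "(a - b) * C (1/5) > 0" using ab(4) w(1) AB[OF t5(3)] by (metis mult_pos_pos)
    then have "a > b" using CD[OF t5(3)] by (simp add: zero_less_mult_iff)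
    then have b: "b = 0" using ab by auto
    have "r\<^sup>2 * ((A (1/5))\<^sup>2 + (B (1/5))\<^sup>2) = a\<^sup>2 * ((C (1/5))\<^sup>2 + (D (1/5))\<^sup>2)"
      using ab(4,5) b by (simp add: distrib_left flip: power_mult_distrib)
    then have "r\<^sup>2 = a\<^sup>2" using AB[OF t5(3)] CD[OF t5(3)] by simp
    then have "r = a" using w(1) ab(1) by (simp add: power2_eq_iff_nonneg)
    then show "A (1/5) = C (1/5)" "B (1/5) = D (1/5)" using ab(4,5) b w(1) by auto
  qed
qed

section \<open>The four foldings\<close>

lemma C1_differentiable_on_realI:
  assumes "\<And>x. x \<in> S \<Longrightarrow> (f has_real_derivative D x) (at x)" "continuous_on S D"
  shows "f C1_differentiable_on S"
  unfolding C1_differentiable_on_def has_real_derivative_iff_has_vector_derivative[symmetric]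
  using assms by (intro exI[of _ D]) simp

lemma C1_differentiable_on_realE:
  assumes "f C1_differentiable_on S"
  obtains D where "\<And>x. x \<in> S \<Longrightarrow> (f has_real_derivative D x) (at x)" "continuous_on S D"
proof -
  obtain D where "\<forall>x\<in>S. (f has_vector_derivative D x) (at x)" "continuous_on S D"
    using assms unfolding C1_differentiable_on_def by blast
  then show ?thesis
    by (intro that[of D]) (simp_all add: has_real_derivative_iff_has_vector_derivative)
qed

lemma C1_compose_deriv:
  fixes f g :: "real \<Rightarrow> real"
  assumes f: "f C1_differentiable_on S"
    and g: "\<And>x. x \<in> f ` S \<Longrightarrow> (g has_real_derivative g' x) (at x)" "continuous_on (f ` S) g'"
  shows "(\<lambda>x. g (f x)) C1_differentiable_on S"
proof -
  obtain D where D: "\<And>x. x \<in> S \<Longrightarrow> (f has_real_derivative D x) (at x)" "continuous_on S D"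
    using C1_differentiable_on_realE[OF f] by blast
  have "((\<lambda>x. g (f x)) has_real_derivative g' (f x) * D x) (at x)" if "x \<in> S" for x
    using DERIV_chain2[OF g(1) D(1)] that by blast
  moreover have "continuous_on S f"
    using D(1) DERIV_isCont continuous_at_imp_continuous_on by blast
  then have "continuous_on S (\<lambda>x. g' (f x) * D x)"
    by (intro continuous_intros continuous_on_compose2[OF g(2)] D(2)) auto
  ultimately show ?thesis by (rule C1_differentiable_on_realI)
qed

lemma C1_differentiable_on_sin:
  fixes f :: "real \<Rightarrow> real"
  shows "f C1_differentiable_on S \<Longrightarrow> (\<lambda>x. sin (f x)) C1_differentiable_on S"
  by (erule C1_compose_deriv) (auto intro!: DERIV_sin continuous_intros)

lemma C1_differentiable_on_cos:
  fixes f :: "real \<Rightarrow> real"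
  shows "f C1_differentiable_on S \<Longrightarrow> (\<lambda>x. cos (f x)) C1_differentiable_on S"
  by (erule C1_compose_deriv) (auto intro!: DERIV_cos continuous_intros)

lemma C1_differentiable_on_divide:
  fixes f g :: "real \<Rightarrow> real"
  assumes "f C1_differentiable_on S" "g C1_differentiable_on S" "\<And>x. x \<in> S \<Longrightarrow> g x \<noteq> 0"
  shows "(\<lambda>x. f x / g x) C1_differentiable_on S"
proof -
  have "(\<lambda>x. inverse (g x)) C1_differentiable_on S"
    by (rule C1_compose_deriv[OF assms(2), where g' = "\<lambda>x. - (inverse x ^ Suc (Suc 0))"])
      (use assms(3) in \<open>auto intro!: DERIV_inverse continuous_intros simp del: power_Suc\<close>)
  then show ?thesis unfolding divide_inverse by (intro C1_differentiable_on_mult assms)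
qed

lemma C1_differentiable_on_power2:
  fixes f :: "real \<Rightarrow> real"
  shows "f C1_differentiable_on S \<Longrightarrow> (\<lambda>x. (f x)\<^sup>2) C1_differentiable_on S"
  unfolding power2_eq_square by (rule C1_differentiable_on_mult)

lemmas C1_intros = C1_differentiable_on_sin C1_differentiable_on_cos C1_differentiable_on_divide
  C1_differentiable_on_power2 C1_differentiable_on_add C1_differentiable_on_diff C1_differentiable_on_minus
  C1_differentiable_on_mult C1_differentiable_on_const C1_differentiable_on_ident

lemma C1_differentiable_on_reflect:
  fixes f :: "real \<Rightarrow> real"
  assumes "f C1_differentiable_on {0<..<1}"
  shows "(\<lambda>t. f (1 - t)) C1_differentiable_on {0<..<1}"
proof -
  have im: "(\<lambda>t::real. 1 - t) ` {0<..<1} \<subseteq> {0<..<1}" by auto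
  obtain D where D: "\<And>x. x \<in> {0<..<1} \<Longrightarrow> (f has_real_derivative D x) (at x)" "continuous_on {0<..<1} D"
    using C1_differentiable_on_realE[OF assms] by blast
  have "(\<lambda>t::real. 1 - t) C1_differentiable_on {0<..<1}" by (intro C1_intros)
  then show ?thesis
    by (rule C1_compose_deriv[OF _ D(1)[OF subsetD[OF im]] continuous_on_subset[OF D(2) im]])
qed

section \<open>Rulings in Frenet coordinates and the normal form of a folding\<close>

definition strip_cot :: "(real \<Rightarrow> real^3) \<Rightarrow> (real \<Rightarrow> real) \<Rightarrow> real \<Rightarrow> real" where
  "strip_cot \<sigma> \<alpha> t = (deriv \<alpha> t + torsion \<sigma> t) / (curvature \<sigma> t * sin (\<alpha> t))"

text \<open>The sine of the second angular function: for \<beta> = pi/2 - arctan c one has sin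
  \<beta> = 1 / sqrt (1 + c^2).\<close>

definition strip_sin :: "(real \<Rightarrow> real^3) \<Rightarrow> (real \<Rightarrow> real) \<Rightarrow> real \<Rightarrow> real" where
  "strip_sin \<sigma> \<alpha> t = 1 / sqrt (1 + (strip_cot \<sigma> \<alpha> t)\<^sup>2)"

lemma strip_sin_bounds: "0 < strip_sin \<sigma> \<alpha> t" "strip_sin \<sigma> \<alpha> t \<le> 1"
  using one_plus_square_pos[of "strip_cot \<sigma> \<alpha> t"]
  by (simp_all add: strip_sin_def)

text \<open>Factoring out sin \<beta> leaves a vector whose component orthogonal to the crease is a
  unit vector, the normalisation used in \<open>crossed_fold\<close>.\<close>

lemma ruling_eq:
  "ruling \<sigma> \<alpha> t = strip_sin \<sigma> \<alpha> t *\<^sub>R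
     (strip_cot \<sigma> \<alpha> t *\<^sub>R tangent \<sigma> t + cos (\<alpha> t) *\<^sub>R normal \<sigma> t + sin (\<alpha> t) *\<^sub>R binormal \<sigma> t)"
  unfolding ruling_def strip_beta_def strip_cot_def[symmetric]
  by (simp add: cos_diff sin_diff sin_arctan cos_arctan strip_sin_def scaleR_add_right)

lemma origami_phi_image:
  "origami_phi \<sigma> \<alpha> ` Omega \<epsilon> =
     {\<sigma> t + s *\<^sub>R ruling \<sigma> \<alpha> t | t s. t \<in> I0 \<and> 0 \<le> s \<and> s < \<epsilon>} \<union>
     {\<sigma> t + s *\<^sub>R (- ruling \<sigma> (\<lambda>s. - \<alpha> s) t) | t s. t \<in> I0 \<and> 0 \<le> s \<and> s < \<epsilon>}" (is "?L = ?M \<union> ?N")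
proof
  show "?L \<subseteq> ?M \<union> ?N"
  proof
    fix x assume "x \<in> ?L"
    then obtain t v where tv: "x = origami_phi \<sigma> \<alpha> (t, v)" "t \<in> I0" "- \<epsilon> < v" "v < \<epsilon>"
      by (auto simp: Omega_def)
    show "x \<in> ?M \<union> ?N"
    proof (cases "v \<ge> 0")
      case True
      then have "x \<in> ?M" using tv by (auto simp: origami_phi_def dev_strip_def)
      then show ?thesis by blast
    next
      case False
      then have "x = \<sigma> t + (- v) *\<^sub>R (- ruling \<sigma> (\<lambda>s. - \<alpha> s) t)" using tv by (auto simp: origami_phi_def dev_strip_def)
      then have "x \<in> ?N" using tv False by (intro CollectI exI[of _ t] exI[of _ "-v"]) simp
      then show ?thesis by blast
    qed
  qed
  show "?M \<union> ?N \<subseteq> ?L"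
  proof
    fix x assume "x \<in> ?M \<union> ?N"
    then consider "x \<in> ?M" | "x \<in> ?N" by blast
    then show "x \<in> ?L"
    proof cases
      case 1
      then obtain t s where "x = \<sigma> t + s *\<^sub>R ruling \<sigma> \<alpha> t" "t \<in> I0" "0 \<le> s" "s < \<epsilon>" by blast
      then show ?thesis
        by (intro image_eqI[of _ _ "(t, s)"]) (auto simp: origami_phi_def dev_strip_def Omega_def)
    next
      case 2
      then obtain t s where "x = \<sigma> t + s *\<^sub>R (- ruling \<sigma> (\<lambda>s. - \<alpha> s) t)" "t \<in> I0" "0 \<le> s" "s < \<epsilon>" by blast
      \<comment> \<open>For s = 0 the pair (t, 0) belongs to the other branch of
        \<open>origami_phi\<close>, but both branches give the crease point there.\<close>
      then show ?thesis
        by (intro image_eqI[of _ _ "(t, - s)"]) (auto simp: origami_phi_def dev_strip_def Omega_def)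
    qed
  qed
qed

text \<open>The factors \<open>k\<close>, \<open>l\<close> will be the sines of the second angles.
  Being at most 1 they keep the rescaled strip coordinate below \<epsilon>; being positive they
  retain the ray.\<close>

lemma crossed_foldI:
  assumes AB: "\<And>t. t \<in> I0 \<Longrightarrow> A t > 0 \<and> B t \<noteq> 0 \<and> (A t)\<^sup>2 + (B t)\<^sup>2 = 1"
    and C1: "x C1_differentiable_on {0<..<1}" "y C1_differentiable_on {0<..<1}"
      "A C1_differentiable_on {0<..<1}" "B C1_differentiable_on {0<..<1}"
    and k: "\<And>t. 0 < k t \<and> k t \<le> 1" and l: "\<And>t. 0 < l t \<and> l t \<le> 1"
    and P: "\<And>\<epsilon>. P \<epsilon> = {c0 t + s *\<^sub>R (k t *\<^sub>R fold_dir x A B t) | t s. t \<in> I0 \<and> 0 \<le> s \<and> s < \<epsilon>} \<union>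
       {c0 t + s *\<^sub>R (l t *\<^sub>R fold_dir y (\<lambda>t. - A t) B t) | t s. t \<in> I0 \<and> 0 \<le> s \<and> s < \<epsilon>}"
  shows "crossed_fold P A B"
proof -
  let ?u = "fold_dir x A B" and ?v = "fold_dir y (\<lambda>t. - A t) B"
  have 1: "?u C1_differentiable_on {0<..<1}" "?v C1_differentiable_on {0<..<1}"
    by (intro fold_dir_C1 C1 C1_differentiable_on_minus)+
  have 2: "\<forall>t\<in>I0. ?u t \<bullet> frame_n t = A t \<and> ?u t \<bullet> frame_b t = B t \<and> ?v t \<bullet> frame_n t = - A t \<and> ?v t \<bullet> frame_b t = B t"
    by (simp add: fold_dir_def inner_add_left inner_diff_left frame_orthonormal)
  have 3: "P \<epsilon> \<subseteq> {c0 t + a *\<^sub>R ?u t + b *\<^sub>R ?v t | t a b. t \<in> I0 \<and> 0 \<le> a \<and> a < \<epsilon> \<and> 0 \<le> b \<and> b < \<epsilon> \<and> a * b = 0}" for \<epsilon>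
  proof
    fix q assume "q \<in> P \<epsilon>"
    then consider t s where "q = c0 t + (s * k t) *\<^sub>R ?u t" "t \<in> I0" "0 \<le> s" "s < \<epsilon>"
      | t s where "q = c0 t + (s * l t) *\<^sub>R ?v t" "t \<in> I0" "0 \<le> s" "s < \<epsilon>"
      unfolding P by auto
    then show "q \<in> {c0 t + a *\<^sub>R ?u t + b *\<^sub>R ?v t | t a b. t \<in> I0 \<and> 0 \<le> a \<and> a < \<epsilon> \<and> 0 \<le> b \<and> b < \<epsilon> \<and> a * b = 0}"
    proof cases
      case 1
      have "s * k t \<le> s" "0 \<le> s * k t" using 1(3) k[of t] by (simp_all add: mult_left_le)
      then show ?thesis
        by - (rule CollectI, rule exI[of _ t], rule exI[of _ "s * k t"], rule exI[of _ 0], use 1 in simp)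
    next
      case 2
      have "s * l t \<le> s" "0 \<le> s * l t" using 2(3) l[of t] by (simp_all add: mult_left_le)
      then show ?thesis
        by - (rule CollectI, rule exI[of _ t], rule exI[of _ 0], rule exI[of _ "s * l t"], use 2 in simp)
    qed
  qed
  have 4: "c0 t \<in> P \<epsilon> \<and> (\<exists>k>0. \<forall>s. 0 \<le> s \<and> s < \<epsilon> \<longrightarrow> c0 t + s *\<^sub>R (k *\<^sub>R ?u t) \<in> P \<epsilon>) \<and>
          (\<exists>k>0. \<forall>s. 0 \<le> s \<and> s < \<epsilon> \<longrightarrow> c0 t + s *\<^sub>R (k *\<^sub>R ?v t) \<in> P \<epsilon>)" if "\<epsilon> > 0" "t \<in> I0" for \<epsilon> t
  proof -
    have u: "c0 t + s *\<^sub>R (k t *\<^sub>R ?u t) \<in> P \<epsilon>" "c0 t + s *\<^sub>R (l t *\<^sub>R ?v t) \<in> P \<epsilon>" if "0 \<le> s" "s < \<epsilon>" for s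
      using that \<open>t \<in> I0\<close> unfolding P by blast+
    have "c0 t \<in> P \<epsilon>" using u(1)[of 0] \<open>\<epsilon> > 0\<close> by simp
    then show ?thesis using u k[of t] l[of t] by blast
  qed
  show ?thesis unfolding crossed_fold_def
    using AB 1 2 3 4 by (intro conjI ballI exI[of _ ?u] exI[of _ ?v] allI impI) simp_all
qed

text \<open>The interval (0, 1) is a neighbourhood of \<open>I0\<close> invariant under t -> 1 - t.
  The derivative must itself be C^1 because it enters the cotangent of the second angle, hence the
  rulings.\<close>

locale angle_function =
  fixes \<alpha> \<alpha>' :: "real \<Rightarrow> real"
  assumes deriv: "0 < t \<Longrightarrow> t < 1 \<Longrightarrow> (\<alpha> has_real_derivative \<alpha>' t) (at t)"
    and C1': "\<alpha>' C1_differentiable_on {0<..<1}"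
    and cos_pos: "0 < t \<Longrightarrow> t < 1 \<Longrightarrow> cos (\<alpha> t) > 0"
    and sin_nz: "0 < t \<Longrightarrow> t < 1 \<Longrightarrow> sin (\<alpha> t) \<noteq> 0"
begin

lemma C1: "\<alpha> C1_differentiable_on {0<..<1}"
proof -
  have "continuous_on {0<..<1} \<alpha>'"
    using C1' by (meson C1_diff_imp_diff differentiable_imp_continuous_on)
  then show ?thesis using deriv by (intro C1_differentiable_on_realI[of _ \<alpha> \<alpha>']) auto
qed

lemma uminus: "angle_function (\<lambda>t. - \<alpha> t) (\<lambda>t. - \<alpha>' t)"
  by unfold_locales (use deriv C1' cos_pos sin_nz in \<open>auto intro!: derivative_intros\<close>)

text \<open>One function \<open>K\<close> stands for both curvature and torsion, which are equal
  along either crease.\<close>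

lemma quotient_C1:
  assumes "K C1_differentiable_on {0<..<1}" "\<And>t. K t \<noteq> 0"
  shows "(\<lambda>t. (\<alpha>' t + K t) / (K t * sin (\<alpha> t))) C1_differentiable_on {0<..<1}"
  using sin_nz by (intro C1_intros C1 C1' assms) (auto simp: assms)

end

text \<open>Serves to replace \<open>deriv \<alpha>\<close> by \<alpha>', as the two are known to
  agree only on the open interval.\<close>

lemma C1_cong:
  assumes "f C1_differentiable_on S" "open S" "\<And>x. x \<in> S \<Longrightarrow> f x = g x"
  shows "g C1_differentiable_on S"
proof -
  obtain D where D: "\<forall>x\<in>S. (f has_vector_derivative D x) (at x)" "continuous_on S D"
    using assms(1) unfolding C1_differentiable_on_def by blast
  have "(g has_vector_derivative D x) (at x)" if "x \<in> S" for x
    by (rule has_vector_derivative_transform_within_open[OF D(1)[rule_format, OF that] assms(2) that assms(3)])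
  then show ?thesis using D(2) unfolding C1_differentiable_on_def by blast
qed

lemma frame_k_C1: "frame_k C1_differentiable_on S" "(\<lambda>t. frame_k (1 - t)) C1_differentiable_on S"
  unfolding frame_k_def[abs_def] by (intro C1_intros; simp add: one_plus_square_pos)+

lemma strip_cot_C1:
  assumes "angle_function \<alpha> \<alpha>'"
  shows "strip_cot c0 \<alpha> C1_differentiable_on {0<..<1}" "strip_cot c0s \<alpha> C1_differentiable_on {0<..<1}"
proof -
  interpret angle_function \<alpha> \<alpha>' by fact
  have k: "frame_k t \<noteq> 0" for t using frame_k_pos[of t] by simp
  have d: "deriv \<alpha> t = \<alpha>' t" if "t \<in> {0<..<1}" for t using that deriv by (auto intro: DERIV_imp_deriv)
  show "strip_cot c0 \<alpha> C1_differentiable_on {0<..<1}"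
    by (rule C1_cong[OF quotient_C1[OF frame_k_C1(1) k]]) (auto simp: strip_cot_def d frenet_c0)
  show "strip_cot c0s \<alpha> C1_differentiable_on {0<..<1}"
    by (rule C1_cong[OF quotient_C1[OF frame_k_C1(2) k]]) (auto simp: strip_cot_def d frenet_c0s)
qed

text \<open>Negating the ruling of the dual strip turns the components (cos, - sin) into (- cos,
  sin), so both halves share the binormal component up to the positive factors
  \<open>strip_sin\<close>.\<close>

lemma crossed_fold_c0:
  assumes "angle_function \<alpha> \<alpha>'"
  shows "crossed_fold (\<lambda>\<epsilon>. origami_phi c0 \<alpha> ` Omega \<epsilon>) (\<lambda>t. cos (\<alpha> t)) (\<lambda>t. sin (\<alpha> t))"
proof (rule crossed_foldI)
  interpret angle_function \<alpha> \<alpha>' by fact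
  show "0 < cos (\<alpha> t) \<and> sin (\<alpha> t) \<noteq> 0 \<and> (cos (\<alpha> t))\<^sup>2 + (sin (\<alpha> t))\<^sup>2 = 1" if "t \<in> I0" for t
    using that cos_pos sin_nz by (auto simp: I0_def)
  show "strip_cot c0 \<alpha> C1_differentiable_on {0<..<1}" by (rule strip_cot_C1[OF assms])
  show "(\<lambda>t. - strip_cot c0 (\<lambda>s. - \<alpha> s) t) C1_differentiable_on {0<..<1}"
    by (intro C1_differentiable_on_minus strip_cot_C1[OF uminus])
  show "(\<lambda>t. cos (\<alpha> t)) C1_differentiable_on {0<..<1}" "(\<lambda>t. sin (\<alpha> t)) C1_differentiable_on {0<..<1}"
    by (intro C1_intros C1)+
  show "0 < strip_sin c0 \<alpha> t \<and> strip_sin c0 \<alpha> t \<le> 1"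
    "0 < strip_sin c0 (\<lambda>s. - \<alpha> s) t \<and> strip_sin c0 (\<lambda>s. - \<alpha> s) t \<le> 1" for t
    using strip_sin_bounds by auto
  have "ruling c0 \<alpha> t = strip_sin c0 \<alpha> t *\<^sub>R fold_dir (strip_cot c0 \<alpha>) (\<lambda>t. cos (\<alpha> t)) (\<lambda>t. sin (\<alpha> t)) t"
    "- ruling c0 (\<lambda>s. - \<alpha> s) t = strip_sin c0 (\<lambda>s. - \<alpha> s) t *\<^sub>R
        fold_dir (\<lambda>t. - strip_cot c0 (\<lambda>s. - \<alpha> s) t) (\<lambda>t. - cos (\<alpha> t)) (\<lambda>t. sin (\<alpha> t)) t" for t
    by (simp_all add: ruling_eq fold_dir_def frenet_c0 algebra_simps)
  then show "origami_phi c0 \<alpha> ` Omega \<epsilon> =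
    {c0 t + s *\<^sub>R (strip_sin c0 \<alpha> t *\<^sub>R fold_dir (strip_cot c0 \<alpha>) (\<lambda>t. cos (\<alpha> t)) (\<lambda>t. sin (\<alpha> t)) t) | t s. t \<in> I0 \<and> 0 \<le> s \<and> s < \<epsilon>} \<union>
    {c0 t + s *\<^sub>R (strip_sin c0 (\<lambda>s. - \<alpha> s) t *\<^sub>R
        fold_dir (\<lambda>t. - strip_cot c0 (\<lambda>s. - \<alpha> s) t) (\<lambda>t. - cos (\<alpha> t)) (\<lambda>t. sin (\<alpha> t)) t) | t s. t \<in> I0 \<and> 0 \<le> s \<and> s < \<epsilon>}" for \<epsilon>
    unfolding origami_phi_image by simp
qed

lemma reindex_reflect:
  "{F t s | t s. t \<in> I0 \<and> R s} = {F (1 - t) s | t s. t \<in> I0 \<and> R s}" for F :: "real \<Rightarrow> 'b \<Rightarrow> 'c"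
proof -
  have "1 - t \<in> I0 \<longleftrightarrow> t \<in> I0" for t by (auto simp: I0_def)
  moreover have "1 - (1 - t) = t" for t :: real by simp
  ultimately show ?thesis by (intro Collect_cong) metis
qed

text \<open>Substituting 1 - t runs through the crease as \<open>c0\<close>. The binormal of
  \<open>c0s\<close> is opposite to \<open>frame_b\<close>, which gives the minus sign in front of
  the sine.\<close>

lemma crossed_fold_c0s:
  assumes "angle_function \<alpha> \<alpha>'"
  shows "crossed_fold (\<lambda>\<epsilon>. origami_phi c0s \<alpha> ` Omega \<epsilon>) (\<lambda>t. cos (\<alpha> (1 - t))) (\<lambda>t. - sin (\<alpha> (1 - t)))"
proof (rule crossed_foldI)
  interpret angle_function \<alpha> \<alpha>' by fact
  let ?x = "\<lambda>t. - strip_cot c0s \<alpha> (1 - t)" and ?y = "\<lambda>t. strip_cot c0s (\<lambda>s. - \<alpha> s) (1 - t)"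
  show "0 < cos (\<alpha> (1 - t)) \<and> - sin (\<alpha> (1 - t)) \<noteq> 0 \<and> (cos (\<alpha> (1 - t)))\<^sup>2 + (- sin (\<alpha> (1 - t)))\<^sup>2 = 1" if "t \<in> I0" for t
    using that cos_pos[of "1 - t"] sin_nz[of "1 - t"] by (auto simp: I0_def)
  show "?x C1_differentiable_on {0<..<1}" "?y C1_differentiable_on {0<..<1}"
    by (intro C1_differentiable_on_minus C1_differentiable_on_reflect strip_cot_C1[OF assms] strip_cot_C1[OF uminus])+
  show "(\<lambda>t. cos (\<alpha> (1 - t))) C1_differentiable_on {0<..<1}" "(\<lambda>t. - sin (\<alpha> (1 - t))) C1_differentiable_on {0<..<1}"
    by (intro C1_intros C1_differentiable_on_reflect C1)+
  show "0 < strip_sin c0s \<alpha> (1 - t) \<and> strip_sin c0s \<alpha> (1 - t) \<le> 1"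
    "0 < strip_sin c0s (\<lambda>s. - \<alpha> s) (1 - t) \<and> strip_sin c0s (\<lambda>s. - \<alpha> s) (1 - t) \<le> 1" for t
    using strip_sin_bounds by auto
  have eq: "ruling c0s \<alpha> (1 - t) = strip_sin c0s \<alpha> (1 - t) *\<^sub>R fold_dir ?x (\<lambda>t. cos (\<alpha> (1 - t))) (\<lambda>t. - sin (\<alpha> (1 - t))) t"
    "- ruling c0s (\<lambda>s. - \<alpha> s) (1 - t) = strip_sin c0s (\<lambda>s. - \<alpha> s) (1 - t) *\<^sub>R
        fold_dir ?y (\<lambda>t. - cos (\<alpha> (1 - t))) (\<lambda>t. - sin (\<alpha> (1 - t))) t"
    "c0s (1 - t) = c0 t" for t
    by (simp_all add: ruling_eq fold_dir_def frenet_c0s algebra_simps c0s_def)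
  show "origami_phi c0s \<alpha> ` Omega \<epsilon> =
    {c0 t + s *\<^sub>R (strip_sin c0s \<alpha> (1 - t) *\<^sub>R fold_dir ?x (\<lambda>t. cos (\<alpha> (1 - t))) (\<lambda>t. - sin (\<alpha> (1 - t))) t) | t s. t \<in> I0 \<and> 0 \<le> s \<and> s < \<epsilon>} \<union>
    {c0 t + s *\<^sub>R (strip_sin c0s (\<lambda>s. - \<alpha> s) (1 - t) *\<^sub>R
        fold_dir ?y (\<lambda>t. - cos (\<alpha> (1 - t))) (\<lambda>t. - sin (\<alpha> (1 - t))) t) | t s. t \<in> I0 \<and> 0 \<le> s \<and> s < \<epsilon>}" for \<epsilon>
    unfolding origami_phi_image
      reindex_reflect[of "\<lambda>t s. c0s t + s *\<^sub>R ruling c0s \<alpha> t" "\<lambda>s. 0 \<le> s \<and> s < \<epsilon>"]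
      reindex_reflect[of "\<lambda>t s. c0s t + s *\<^sub>R (- ruling c0s (\<lambda>s. - \<alpha> s) t)" "\<lambda>s. 0 \<le> s \<and> s < \<epsilon>"] eq ..
qed

section \<open>The two angle functions of the example\<close>

text \<open>The bound pi/3 gives cos < 1/2, which offsets the ratio of the curvatures at t and 1 -
  t, at most 2 on (0, 1); thus the argument of \<open>arccos\<close> in \<open>alphas\<close> stays
  below 1.\<close>

lemma alpha0_range:
  assumes "0 < t" "t < 1"
  shows "pi / 3 < alpha0 t" "alpha0 t < pi / 2"
proof -
  have "pi / 3 < pi * (10 / 24)" "pi * (t + 10) > pi * 10" "pi * (t + 10) < pi * 12"
    using assms pi_gt_zero by (auto intro!: mult_strict_left_mono)
  then show "pi / 3 < alpha0 t" "alpha0 t < pi / 2" unfolding alpha0_def by linarith+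
qed

lemma angle_function_alpha0: "angle_function alpha0 (\<lambda>_. pi / 24)"
proof
  fix t :: real assume t: "0 < t" "t < 1"
  show "(alpha0 has_real_derivative pi / 24) (at t)"
    unfolding alpha0_def[abs_def] by (auto intro!: derivative_eq_intros)
  have "0 < alpha0 t" using alpha0_range(1)[OF t] pi_gt_zero by linarith
  then show "cos (alpha0 t) > 0" "sin (alpha0 t) \<noteq> 0"
    using alpha0_range(2)[OF t] by (auto intro!: cos_gt_zero less_imp_neq[symmetric] sin_gt_zero2)
qed (rule C1_differentiable_on_const)

text \<open>The quotient of \<open>mu0\<close> by the curvature of \<open>c0s\<close>, with the
  factors sqrt 2 cancelled.\<close>

definition cos_alphas :: "real \<Rightarrow> real" where
  "cos_alphas t = (1 + (1 - t)\<^sup>2) / (1 + t\<^sup>2) * cos (alpha0 t)"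

lemma alphas_eq: "alphas t = arccos (cos_alphas t)"
proof -
  have "frame_k t * cos (alpha0 t) / frame_k (1 - t) = cos_alphas t"
    using one_plus_square_pos(2)[of t] one_plus_square_pos(2)[of "1 - t"]
    by (simp add: frame_k_def cos_alphas_def divide_simps)
  then show ?thesis by (simp add: alphas_def mu0_def frenet_c0 frenet_c0s)
qed

lemma cos_alphas_range:
  assumes t: "0 < t" "t < 1"
  shows "0 < cos_alphas t" "cos_alphas t < 1"
proof -
  have a: "0 < cos (alpha0 t)" using angle_function.cos_pos[OF angle_function_alpha0] t by simp
  have "cos (alpha0 t) < cos (pi / 3)"
    using alpha0_range[OF t] pi_gt_zero by (intro cos_monotone_0_pi) linarith+
  then have b: "cos (alpha0 t) < 1 / 2" by (simp add: cos_60)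
  have "(1 - t)\<^sup>2 \<le> 1" using t by (simp add: power_le_one)
  then have r: "(1 + (1 - t)\<^sup>2) / (1 + t\<^sup>2) \<le> 2" "0 < (1 + (1 - t)\<^sup>2) / (1 + t\<^sup>2)"
    using one_plus_square_pos[of t] one_plus_square_pos[of "1 - t"] by (simp_all add: divide_simps) (smt (verit) zero_le_power2)
  show "0 < cos_alphas t" using mult_pos_pos[OF r(2) a] by (simp only: cos_alphas_def)
  have "cos_alphas t \<le> 2 * cos (alpha0 t)" unfolding cos_alphas_def using r a by (intro mult_right_mono) auto
  then show "cos_alphas t < 1" using b by linarith
qed

text \<open>The derivative is - D / sin of \<open>alphas\<close>, so regularity is bootstrapped:
  differentiability makes this expression continuous, hence \<open>alphas\<close> is C^1, hence the
  expression is C^1.\<close>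

lemma angle_function_alphas: "\<exists>\<alpha>'. angle_function alphas \<alpha>'"
proof -
  define r where "r t = (1 + (1 - t)\<^sup>2) / (1 + t\<^sup>2)" for t :: real
  define r' where "r' t = (- 2 * (1 - t) * (1 + t\<^sup>2) - (1 + (1 - t)\<^sup>2) * (2 * t)) / ((1 + t\<^sup>2) * (1 + t\<^sup>2))" for t :: real
  define D where "D t = r' t * cos (alpha0 t) + r t * (- sin (alpha0 t) * (pi / 24))" for t
  have r': "(r has_real_derivative r' t) (at t)" for t
    unfolding r_def[abs_def] r'_def
    by (rule derivative_eq_intros refl | simp add: one_plus_square_pos)+
  have D: "(cos_alphas has_real_derivative D t) (at t)" for t
    unfolding cos_alphas_def[abs_def] r_def[symmetric] D_def
    by (rule derivative_eq_intros r' refl | simp add: alpha0_def[abs_def])+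
  have a0: "alpha0 C1_differentiable_on S" for S
    unfolding alpha0_def[abs_def] by (intro C1_intros) simp
  have DC1: "D C1_differentiable_on S" for S
    unfolding D_def[abs_def] r_def[abs_def] r'_def[abs_def]
    by (intro C1_intros a0) (simp_all add: one_plus_square_pos)
  define \<alpha>' where "\<alpha>' t = - D t / sin (alphas t)" for t
  have cs: "cos (alphas t) = cos_alphas t" "sin (alphas t) = sqrt (1 - (cos_alphas t)\<^sup>2)" "sin (alphas t) > 0"
    if "0 < t" "t < 1" for t
  proof -
    show "cos (alphas t) = cos_alphas t" using cos_alphas_range[OF that] by (simp add: alphas_eq)
    show s: "sin (alphas t) = sqrt (1 - (cos_alphas t)\<^sup>2)" using cos_alphas_range[OF that] by (simp add: alphas_eq sin_arccos)
    show "sin (alphas t) > 0" unfolding s using cos_alphas_range[OF that] by (simp add: abs_square_less_1)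
  qed
  have der: "(alphas has_real_derivative \<alpha>' t) (at t)" if t: "0 < t" "t < 1" for t
  proof -
    have "((\<lambda>t. arccos (cos_alphas t)) has_real_derivative inverse (- sqrt (1 - (cos_alphas t)\<^sup>2)) * D t) (at t)"
      using cos_alphas_range[OF t] by (intro DERIV_chain2[OF DERIV_arccos D]) auto
    moreover have "inverse (- sqrt (1 - (cos_alphas t)\<^sup>2)) * D t = \<alpha>' t"
      by (simp add: \<alpha>'_def cs(2)[OF t] divide_inverse mult.commute)
    moreover have "alphas = (\<lambda>t. arccos (cos_alphas t))" by (simp add: fun_eq_iff alphas_eq)
    ultimately show ?thesis by simp
  qed
  have snz: "sin (alphas t) \<noteq> 0" if "t \<in> {0<..<1}" for t using cs(3)[of t] that by simp
  have "continuous_on {0<..<1} alphas"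
    using DERIV_isCont[OF der] by (intro continuous_at_imp_continuous_on) simp
  moreover have "continuous_on {0<..<1} D"
    using DC1 by (meson C1_diff_imp_diff differentiable_imp_continuous_on)
  ultimately have "continuous_on {0<..<1} \<alpha>'"
    unfolding \<alpha>'_def[abs_def] by (intro continuous_intros) (auto simp: snz)
  then have "alphas C1_differentiable_on {0<..<1}"
    using der by (intro C1_differentiable_on_realI[of _ alphas \<alpha>']) auto
  then have "\<alpha>' C1_differentiable_on {0<..<1}"
    unfolding \<alpha>'_def[abs_def] using snz by (intro C1_intros DC1)
  then have "angle_function alphas \<alpha>'"
    using der snz cos_alphas_range by unfold_locales (simp_all add: cs(1))
  then show ?thesis by blast
qed

text \<open>The curvature ratio at 4/5 is 26/41 < 1, and the increasing angle \<open>alpha0\<close>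
  has a smaller cosine at 4/5 than at 1/5.\<close>

lemma folding_angles_differ: "cos (alphas (4/5)) < cos (alpha0 (1/5))"
proof -
  have "cos (alphas (4/5)) = 26 / 41 * cos (alpha0 (4/5))"
    using cos_alphas_range[of "4/5"] by (simp add: alphas_eq) (simp add: cos_alphas_def power2_eq_square)
  moreover have "cos (alpha0 (4/5)) < cos (alpha0 (1/5))"
    using alpha0_range[of "1/5"] alpha0_range[of "4/5"] pi_gt_zero
    by (intro cos_monotone_0_pi) (auto simp: alpha0_def)
  moreover have "0 < cos (alpha0 (4/5))"
    using angle_function.cos_pos[OF angle_function_alpha0, of "4/5"] by simp
  ultimately show ?thesis by linarith
qed

theorem theoremB:
  shows "\<exists>\<epsilon>0>0. \<forall>\<epsilon> \<delta> (i::nat) j T.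
           0 < \<epsilon> \<and> \<epsilon> \<le> \<epsilon>0 \<and> 0 < \<delta> \<and> \<delta> \<le> \<epsilon> \<and>
           i \<in> {1,2,3,4} \<and> j \<in> {1,2,3,4} \<and>
           isometry3 T \<and> T ` Pfold i \<delta> \<subseteq> Pfold j \<epsilon> \<longrightarrow> i = j"
proof -
  let ?N = "{1,2,3,4} :: nat set"
  \<comment> \<open>Values of (A, B) at 1/5 for the four foldings. The cosine separates {1, 2} from
    {3, 4}, and the sign of the nonzero sine separates within each pair.\<close>
  define a b where "a i = (if i \<le> 2 then cos (alpha0 (1/5)) else cos (alphas (4/5)))"
    and "b i = (if i = 1 then sin (alpha0 (1/5)) else if i = 2 then - sin (alpha0 (1/5))
       else if i = 3 then - sin (alphas (4/5)) else sin (alphas (4/5)))" for i :: nat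
  obtain \<alpha>' where s: "angle_function alphas \<alpha>'" using angle_function_alphas by blast
  note folds = crossed_fold_c0[OF angle_function_alpha0]
    crossed_fold_c0[OF angle_function.uminus[OF angle_function_alpha0]]
    crossed_fold_c0s[OF s] crossed_fold_c0s[OF angle_function.uminus[OF s]]
  have fold: "\<exists>A B. crossed_fold (Pfold i) A B \<and> A (1/5) = a i \<and> B (1/5) = b i" if i: "i \<in> ?N" for i
  proof -
    consider "i = 1" | "i = 2" | "i = 3" | "i = 4" using i by auto
    then show ?thesis
    proof cases
      case 1
      then have "Pfold i = (\<lambda>\<epsilon>. origami_phi c0 alpha0 ` Omega \<epsilon>)" by (simp add: Pfold_def fun_eq_iff)
      with folds(1) 1 show ?thesis by (intro exI conjI) (simp, simp_all add: a_def b_def)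
    next
      case 2
      then have "Pfold i = (\<lambda>\<epsilon>. origami_phi c0 (\<lambda>s. - alpha0 s) ` Omega \<epsilon>)" by (simp add: Pfold_def fun_eq_iff)
      with folds(2) have "crossed_fold (Pfold i) (\<lambda>t. cos (- alpha0 t)) (\<lambda>t. sin (- alpha0 t))" by simp
      with 2 show ?thesis by (intro exI conjI) (assumption, simp_all add: a_def b_def)
    next
      case 3
      then have "Pfold i = (\<lambda>\<epsilon>. origami_phi c0s alphas ` Omega \<epsilon>)" by (simp add: Pfold_def fun_eq_iff)
      with folds(3) have "crossed_fold (Pfold i) (\<lambda>t. cos (alphas (1 - t))) (\<lambda>t. - sin (alphas (1 - t)))" by simp
      with 3 show ?thesis by (intro exI conjI) (assumption, simp_all add: a_def b_def)
    next
      case 4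
      then have "Pfold i = (\<lambda>\<epsilon>. origami_phi c0s (\<lambda>s. - alphas s) ` Omega \<epsilon>)" by (simp add: Pfold_def fun_eq_iff)
      with folds(4) have "crossed_fold (Pfold i) (\<lambda>t. cos (- alphas (1 - t))) (\<lambda>t. - sin (- alphas (1 - t)))" by simp
      with 4 show ?thesis by (intro exI conjI) (assumption, simp_all add: a_def b_def)
    qed
  qed
  have "\<forall>p \<in> ?N \<times> ?N. \<exists>e>0. \<forall>\<epsilon> \<delta> T. \<epsilon> \<le> e \<and> 0 < \<delta> \<and> isometry3 T \<and> T ` Pfold (fst p) \<delta> \<subseteq> Pfold (snd p) \<epsilon> \<longrightarrow>
      a (fst p) = a (snd p) \<and> b (fst p) = b (snd p)"
  proof
    fix p assume p: "p \<in> ?N \<times> ?N"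
    obtain A B where 1: "crossed_fold (Pfold (fst p)) A B" "A (1/5) = a (fst p)" "B (1/5) = b (fst p)"
      using fold[of "fst p"] p by auto
    obtain C D where 2: "crossed_fold (Pfold (snd p)) C D" "C (1/5) = a (snd p)" "D (1/5) = b (snd p)"
      using fold[of "snd p"] p by auto
    show "\<exists>e>0. \<forall>\<epsilon> \<delta> T. \<epsilon> \<le> e \<and> 0 < \<delta> \<and> isometry3 T \<and> T ` Pfold (fst p) \<delta> \<subseteq> Pfold (snd p) \<epsilon> \<longrightarrow>
      a (fst p) = a (snd p) \<and> b (fst p) = b (snd p)"
      using fold_containment_rigid[OF 1(1) 2(1)] unfolding 1(2,3) 2(2,3) .
  qed
  from bchoice[OF this] obtain e where e: "\<forall>p \<in> ?N \<times> ?N. e p > 0 \<and> (\<forall>\<epsilon> \<delta> T. \<epsilon> \<le> e p \<and> 0 < \<delta> \<and> isometry3 T \<and>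
      T ` Pfold (fst p) \<delta> \<subseteq> Pfold (snd p) \<epsilon> \<longrightarrow> a (fst p) = a (snd p) \<and> b (fst p) = b (snd p))" ..
  \<comment> \<open>The threshold depends on the pair of foldings; the least over the sixteen pairs
    serves all.\<close>
  define e0 where "e0 = Min (e ` (?N \<times> ?N))"
  have fin: "finite (e ` (?N \<times> ?N))" and ne: "e ` (?N \<times> ?N) \<noteq> {}" by blast+
  have pos: "e0 > 0"
    unfolding e0_def Min_gr_iff[OF fin ne] using e by blast
  have le: "e0 \<le> e p" if "p \<in> ?N \<times> ?N" for p
    unfolding e0_def by (rule Min_le[OF fin imageI[OF that]])
  have sin0: "sin (alpha0 (1/5)) \<noteq> 0" using angle_function.sin_nz[OF angle_function_alpha0, of "1/5"] by simp
  have sins: "sin (alphas (4/5)) \<noteq> 0" using angle_function.sin_nz[OF s, of "4/5"] by simp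
  have sep: "i = j" if "i \<in> ?N" "j \<in> ?N" "a i = a j \<and> b i = b j" for i j
    using that folding_angles_differ sin0 sins unfolding a_def b_def by (auto split: if_splits)
  show ?thesis
  proof (intro exI[of _ e0] conjI allI impI pos)
    fix \<epsilon> \<delta> i j T
    assume h: "0 < \<epsilon> \<and> \<epsilon> \<le> e0 \<and> 0 < \<delta> \<and> \<delta> \<le> \<epsilon> \<and> i \<in> ?N \<and> j \<in> ?N \<and> isometry3 T \<and> T ` Pfold i \<delta> \<subseteq> Pfold j \<epsilon>"
    then have p: "(i, j) \<in> ?N \<times> ?N" by blast
    have "a i = a j \<and> b i = b j"
      using bspec[OF e p, THEN conjunct2, rule_format, of \<epsilon> \<delta> T] le[OF p] h by auto
    then show "i = j" using sep h by blast
  qed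
qed

end
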